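(* Let $(M,\rho)$ be a compact hyperbolic manifold, let $\mathcal{S}$ be any finite generating set of $\pi_1(M)$, and let $\mathrm{F}_{\pi_1(M),\mathcal{S}}$ and $\mathrm{F}_{M,\rho}$ be the residual finiteness function of $\pi_1(M)$ and the geodesic residual finiteness function of $M$, respectively. Then $\mathrm{F}_{\pi_1(M),\mathcal{S}} \simeq \mathrm{F}_{M,\rho}$.
   Context: A compact hyperbolic manifold $(M,\rho)$ is a compact connected Riemannian manifold of constant curvature $-1$, possibly with boundary, whose universal cover $\widetilde M$ embeds isometrically as a closed convex subset of hyperbolic space $\mathbf{H}^n$ (all of $\mathbf{H}^n$ if $M$ is closed), with the deck action of $\pi_1(M)$ extending to a free, properly discontinuous isometric action on $\mathbf{H}^n$. For $\alpha \in \pi_1(M)-\{1\}$, $\ell_\rho(\alpha)$ denotes the length of the unique geodesic representative of $\alpha$ in $(M,\rho)$, i.e. the translation length of $\alpha$ along its axis. For a group $G$ and $g \in G-\{1\}$ the divisibility function is $D_G(g) = \min\{[G:H] : H \le G,\ g \notin H\}$. For a group $G$ with finite generating set $\mathcal{S}$ and word-length norm $\|\cdot\|_{\mathcal{S}}$, the residual finiteness function $\mathrm{F}_{G,\mathcal{S}}(n)$ is the maximum of $D_G(g)$ over $g \in G-\{1\}$ with $\|g\|_{\mathcal{S}} \le n$. The geodesic residual finiteness function $\mathrm{F}_{M,\rho}(n)$ is the maximum of $D_{\pi_1(M)}(\alpha)$ over $\alpha \in \pi_1(M)-\{1\}$ with $\ell_\rho(\alpha) \le n$. Both make sense for any real $n>0$,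 and a maximum over the empty set is taken to be $1$. For functions $f,g$ on the positive integers (here both also defined at positive reals), $f \preceq g$ means there is a constant $C>0$ such that $f(n) \le C\, g(Cn)$ for all $n$; and $f \simeq g$ means $f \preceq g$ and $g \preceq f$. *)

theory Defs
  imports
    "HOL-Analysis.Analysis"
    "HOL-Algebra.Coset"
    "HOL-Algebra.Bij"
    "HOL-Algebra.Generated_Groups"
    "HOL-Library.Extended_Nat"
begin

section \<open>Hyperbolic space\<close>

text \<open>
  The hyperboloid model: the upper sheet of the two-sheeted hyperboloid in Minkowski space, whose
  last coordinate is time. The hyperbolic distance induces on it the subspace topology of the
  ambient Euclidean space, so topological notions below are those of the library.
\<close>

definition hyp_space :: "((real ^ 'n) \<times> real) set" where
  "hyp_space = {x. snd x > 0 \<and> (snd x)\<^sup>2 - fst x \<bullet> fst x = 1}"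

definition hyp_dist :: "(real ^ 'n) \<times> real \<Rightarrow> (real ^ 'n) \<times> real \<Rightarrow> real" where
  "hyp_dist x y = arcosh (snd x * snd y - fst x \<bullet> fst y)"

definition hyp_geodesic_on :: "real set \<Rightarrow> (real \<Rightarrow> (real ^ 'n) \<times> real) \<Rightarrow> bool" where
  "hyp_geodesic_on I c \<longleftrightarrow>
     c ` I \<subseteq> hyp_space \<and> (\<forall>s\<in>I. \<forall>t\<in>I. hyp_dist (c s) (c t) = \<bar>s - t\<bar>)"

definition hyp_convex :: "((real ^ 'n) \<times> real) set \<Rightarrow> bool" where
  "hyp_convex C \<longleftrightarrow> C \<subseteq> hyp_space \<and>
     (\<forall>c L. 0 \<le> L \<and> hyp_geodesic_on {0..L} c \<and> c 0 \<in> C \<and> c L \<in> C \<longrightarrow> c ` {0..L} \<subseteq> C)"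

definition hyp_isometries :: "((real ^ 'n) \<times> real \<Rightarrow> (real ^ 'n) \<times> real) set" where
  "hyp_isometries = {f \<in> Bij hyp_space.
     \<forall>x\<in>hyp_space. \<forall>y\<in>hyp_space. hyp_dist (f x) (f y) = hyp_dist x y}"

definition free_isometric_action ::
    "((real ^ 'n) \<times> real \<Rightarrow> (real ^ 'n) \<times> real) set \<Rightarrow> bool" where
  "free_isometric_action \<Gamma> \<longleftrightarrow>
     subgroup \<Gamma> (BijGroup hyp_space) \<and> \<Gamma> \<subseteq> hyp_isometries \<and>
     (\<forall>\<gamma>\<in>\<Gamma>. \<forall>x\<in>hyp_space. \<gamma> x = x \<longrightarrow> \<gamma> = \<one>\<^bsub>BijGroup hyp_space\<^esub>)"

definition properly_discontinuous ::
    "((real ^ 'n) \<times> real \<Rightarrow> (real ^ 'n) \<times> real) set \<Rightarrow> bool" where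
  "properly_discontinuous \<Gamma> \<longleftrightarrow>
     (\<forall>K. compact K \<and> K \<subseteq> hyp_space \<longrightarrow> finite {\<gamma> \<in> \<Gamma>. \<gamma> ` K \<inter> K \<noteq> {}})"


section \<open>Compact hyperbolic manifolds\<close>

definition deck_transformations ::
    "'a::topological_space set \<Rightarrow> ('a \<Rightarrow> 'b) \<Rightarrow> ('a \<Rightarrow> 'a) set" where
  "deck_transformations C p =
     {f \<in> Bij C. (\<exists>g. homeomorphism C C f g) \<and> (\<forall>x\<in>C. p (f x) = p x)}"

text \<open>
  \<^term>\<open>M\<close> is a set in a metric space, and \<^term>\<open>dist\<close> restricted to \<^term>\<open>M\<close> is the Riemannian
  distance. The space \<^term>\<open>C\<close> is the universal cover, already embedded in hyperbolic space, with
  projection \<^term>\<open>p\<close>, and \<^term>\<open>\<Gamma>\<close> is the group of extensions of the deck transformations.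

  That \<^term>\<open>p\<close> is a Riemannian covering is the condition on \<^term>\<open>dist\<close>: the Riemannian distance is
  the infimum of the lengths of curves, curves in \<^term>\<open>M\<close> lift to \<^term>\<open>C\<close> with the same length, and
  in the convex set \<^term>\<open>C\<close> the shortest curves are the hyperbolic geodesic segments; hence the
  distance of two points of \<^term>\<open>M\<close> is the infimal hyperbolic distance of their lifts.

  The nonempty interior says that \<^term>\<open>C\<close>, and therefore \<^term>\<open>M\<close>, has the dimension of the ambient
  hyperbolic space. A closed convex set with nonempty interior is a manifold with (possibly empty)
  boundary, which need not be smooth; if it has no boundary it is the whole hyperbolic space.
\<close>

definition compact_hyperbolic_manifold ::
    "'n::finite itself \<Rightarrow> 'm::metric_space set \<Rightarrow> bool" where
  "compact_hyperbolic_manifold _ M \<longleftrightarrow>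
     compact M \<and> connected M \<and>
     (\<exists>(C :: ((real ^ 'n) \<times> real) set) p \<Gamma>.
        closed C \<and> hyp_convex C \<and>
        (\<exists>U. openin (top_of_set hyp_space) U \<and> U \<noteq> {} \<and> U \<subseteq> C) \<and>
        covering_space C p M \<and> simply_connected C \<and>
        (\<forall>x\<in>C. \<forall>y\<in>C. dist (p x) (p y) =
           Inf {hyp_dist x' y' | x' y'. x' \<in> C \<and> y' \<in> C \<and> p x' = p x \<and> p y' = p y}) \<and>
        free_isometric_action \<Gamma> \<and> properly_discontinuous \<Gamma> \<and>
        (\<lambda>\<gamma>. restrict \<gamma> C) ` \<Gamma> = deck_transformations C p)"


section \<open>The fundamental group and lengths of geodesic representatives\<close>

definition based_loops :: "'m::topological_space set \<Rightarrow> 'm \<Rightarrow> (real \<Rightarrow> 'm) set" where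
  "based_loops M x0 = {f. path f \<and> path_image f \<subseteq> M \<and> pathstart f = x0 \<and> pathfinish f = x0}"

definition path_class :: "'m::topological_space set \<Rightarrow> (real \<Rightarrow> 'm) \<Rightarrow> (real \<Rightarrow> 'm) set" where
  "path_class M f = {g. homotopic_paths M f g}"

definition fundamental_group ::
    "'m::topological_space set \<Rightarrow> 'm \<Rightarrow> (real \<Rightarrow> 'm) set monoid" where
  "fundamental_group M x0 =
     \<lparr>carrier = path_class M ` based_loops M x0,
      mult = (\<lambda>\<alpha> \<beta>. {h. \<exists>f\<in>\<alpha>. \<exists>g\<in>\<beta>. homotopic_paths M (f +++ g) h}),
      one = path_class M (\<lambda>_. x0)\<rparr>"

text \<open>
  A unit-speed closed geodesic of length \<^term>\<open>L\<close>, given as an \<^term>\<open>L\<close>-periodic local isometry of the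
  line; \<^term>\<open>L\<close> need not be the least period, so multiply traversed geodesics are included.
\<close>

definition closed_geodesic :: "'m::metric_space set \<Rightarrow> real \<Rightarrow> (real \<Rightarrow> 'm) \<Rightarrow> bool" where
  "closed_geodesic M L c \<longleftrightarrow>
     L > 0 \<and> range c \<subseteq> M \<and> (\<forall>t. c (t + L) = c t) \<and>
     (\<forall>t. \<exists>e>0. \<forall>s\<in>ball t e. \<forall>s'\<in>ball t e. dist (c s) (c s') = \<bar>s - s'\<bar>)"

text \<open>
  The geodesic representative is taken in the free homotopy class of loops; the length is only used
  for nontrivial elements.
\<close>

definition geodesic_length :: "'m::metric_space set \<Rightarrow> (real \<Rightarrow> 'm) set \<Rightarrow> real" where
  "geodesic_length M \<alpha> =
     (THE L. \<exists>c. closed_geodesic M L c \<and> (\<exists>f\<in>\<alpha>. homotopic_loops M f (\<lambda>t. c (L * t))))"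


section \<open>Residual finiteness functions\<close>

definition subgroup_index :: "('a, 'b) monoid_scheme \<Rightarrow> 'a set \<Rightarrow> enat" where
  "subgroup_index G H = (if finite (rcosets\<^bsub>G\<^esub> H) then enat (card (rcosets\<^bsub>G\<^esub> H)) else \<infinity>)"

definition divisibility :: "('a, 'b) monoid_scheme \<Rightarrow> 'a \<Rightarrow> enat" where
  "divisibility G g = Inf {subgroup_index G H | H. subgroup H G \<and> g \<notin> H}"

definition word_norm :: "('a, 'b) monoid_scheme \<Rightarrow> 'a set \<Rightarrow> 'a \<Rightarrow> nat" where
  "word_norm G S g = (LEAST k. \<exists>w. length w = k \<and>
     set w \<subseteq> S \<union> (\<lambda>s. inv\<^bsub>G\<^esub> s) ` S \<and> foldr (\<lambda>x y. x \<otimes>\<^bsub>G\<^esub> y) w \<one>\<^bsub>G\<^esub> = g)"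

text \<open>
  A maximum of extended naturals with the convention that the empty maximum is 1. The supremum is
  attained as soon as it is finite.
\<close>

definition max_or_one :: "enat set \<Rightarrow> enat" where
  "max_or_one A = (if A = {} then 1 else Sup A)"

definition residual_finiteness ::
    "('a, 'b) monoid_scheme \<Rightarrow> 'a set \<Rightarrow> real \<Rightarrow> enat" where
  "residual_finiteness G S r = max_or_one
     (divisibility G ` {g \<in> carrier G - {\<one>\<^bsub>G\<^esub>}. real (word_norm G S g) \<le> r})"

definition geodesic_residual_finiteness ::
    "'m::metric_space set \<Rightarrow> 'm \<Rightarrow> real \<Rightarrow> enat" where
  "geodesic_residual_finiteness M x0 r = max_or_one
     (divisibility (fundamental_group M x0) `
        {\<alpha> \<in> carrier (fundamental_group M x0) - {\<one>\<^bsub>fundamental_group M x0\<^esub>}.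
           geodesic_length M \<alpha> \<le> r})"


section \<open>Comparison of growth\<close>

definition growth_le :: "(real \<Rightarrow> enat) \<Rightarrow> (real \<Rightarrow> enat) \<Rightarrow> bool" where
  "growth_le f g \<longleftrightarrow>
     (\<exists>C::real. C > 0 \<and> (\<forall>n>0. ereal_of_enat (f n) \<le> ereal C * ereal_of_enat (g (C * n))))"

definition growth_equiv :: "(real \<Rightarrow> enat) \<Rightarrow> (real \<Rightarrow> enat) \<Rightarrow> bool" where
  "growth_equiv f g \<longleftrightarrow> growth_le f g \<and> growth_le g f"

end

theory Submission
  imports Defs
begin

text \<open>
  The group \<open>\<pi>\<^sub>1(M)\<close> acts on the convex set \<open>C\<close> as the deck group of the universal covering. Every
  nontrivial element \<open>\<gamma>\<close> attains its minimal displacement, since \<open>M\<close> is compact and the action is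
  proper, and a point of minimal displacement lies on an axis, a hyperbolic line translated by
  \<open>\<gamma>\<close>. Axes project to closed geodesics, and conversely closed geodesics lift to axes because
  local geodesics of hyperbolic space are global. The translation length is unique, being the
  limit of \<open>d(x, \<gamma>\<^sup>n x) / n\<close>, and so the length of the geodesic representative is the minimal
  displacement of \<open>\<gamma>\<close>.

  In particular this length is at most the displacement of the base point, which is at most linear
  in the word length. Conversely some conjugate of \<open>\<gamma>\<close> displaces the base point by at most the
  translation length plus a constant, so by the Svarc--Milnor lemma its word length is bounded by an
  affine function of the translation length. Divisibility is a conjugacy invariant, and the
  additive constant is absorbed because translation lengths are bounded away from zero: up to
  conjugacy only finitely many elements have translation length at most 1.
\<close>

section \<open>The hyperboloid\<close>

text \<open>\<open>geodesic_length\<close> is a definite description, so nothing can be said about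
  it before existence and uniqueness of the length are known for loops in \<open>M\<close>. Both are
  settled upstairs: the infimum formula for \<open>dist\<close> makes \<open>p\<close>
  distance-preserving near each point, so that being a local geodesic can be tested in
  \<open>C\<close>, and a free homotopy lifts to a square in \<open>C\<close> with two opposite
  sides that differ by a deck element. In \<open>C\<close> the geometry is linear algebra of the
  Lorentz form: a geodesic has the form cosh t a + sinh t b and is determined by two of its values.
  This rigidity makes local geodesics global, prolongs a shortest segment to an axis, and shows that
  the deck element translates that axis.

  The growth comparison is demanded at every real n > 0, arbitrarily small ones included, so an
  additive constant cannot be absorbed by a bound n >= 1. It has to be at most a multiple of the
  length of each single element, which is why a positive lower bound on lengths is needed.\<close>

definition lorentz :: "(real ^ 'n) \<times> real \<Rightarrow> (real ^ 'n) \<times> real \<Rightarrow> real" where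
  "lorentz x y = snd x * snd y - fst x \<bullet> fst y"

lemma lorentz_simps [simp]:
  "lorentz (x + y) z = lorentz x z + lorentz y z"
  "lorentz z (x + y) = lorentz z x + lorentz z y"
  "lorentz (x - y) z = lorentz x z - lorentz y z"
  "lorentz z (x - y) = lorentz z x - lorentz z y"
  "lorentz (r *\<^sub>R x) z = r * lorentz x z"
  "lorentz z (r *\<^sub>R x) = r * lorentz z x"
  by (simp_all add: lorentz_def algebra_simps inner_simps)

lemma lorentz_commute: "lorentz x y = lorentz y x"
  by (simp add: lorentz_def inner_commute mult.commute)

lemma continuous_on_lorentz [continuous_intros]:
  assumes "continuous_on S f" "continuous_on S g"
  shows "continuous_on S (\<lambda>x. lorentz (f x) (g x))"
  unfolding lorentz_def by (intro continuous_intros assms)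

lemma hyp_space_iff: "x \<in> hyp_space \<longleftrightarrow> snd x > 0 \<and> lorentz x x = 1"
  by (simp add: hyp_space_def lorentz_def power2_eq_square)

lemma hyp_space_snd: "x \<in> hyp_space \<Longrightarrow> (snd x)\<^sup>2 = 1 + (norm (fst x))\<^sup>2"
  by (simp add: hyp_space_def power2_norm_eq_inner)

lemma hyp_space_norm_fst_less:
  assumes "x \<in> hyp_space" shows "norm (fst x) < snd x"
proof -
  have "(norm (fst x))\<^sup>2 < (snd x)\<^sup>2" using hyp_space_snd[OF assms] by simp
  then show ?thesis
    using assms by (auto simp: hyp_space_def intro: power_less_imp_less_base)
qed

text \<open>Tells the two sheets apart: for \<open>snd x \<le> 0\<close> Cauchy-Schwarz makes the
  pairing with a point of the upper sheet nonpositive. This keeps \<open>hyp_line\<close> on the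
  upper sheet.\<close>

lemma lorentz_pos_imp_snd_pos:
  assumes "lorentz x x \<ge> 0" "a \<in> hyp_space" "lorentz x a > 0"
  shows "snd x > 0"
proof (rule ccontr)
  assume "\<not> snd x > 0"
  have "(norm (fst x))\<^sup>2 \<le> (snd x)\<^sup>2"
    using assms(1) by (simp add: lorentz_def power2_norm_eq_inner power2_eq_square[of "snd x"])
  then have "norm (fst x) \<le> \<bar>snd x\<bar>"
    by (metis abs_norm_cancel abs_le_square_iff)
  then have "norm (fst x) * norm (fst a) \<le> \<bar>snd x\<bar> * snd a"
    using hyp_space_norm_fst_less[OF assms(2)] by (intro mult_mono) auto
  moreover have "- (fst x \<bullet> fst a) \<le> norm (fst x) * norm (fst a)"
    using Cauchy_Schwarz_ineq2[of "fst x" "fst a"] by linarith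
  ultimately show False
    using assms(3) \<open>\<not> snd x > 0\<close> by (simp add: lorentz_def)
qed

text \<open>The vectors orthogonal to \<open>a\<close> form the tangent space at \<open>a\<close>.
  The form has a single positive direction, used up by \<open>a\<close>, so it is negative definite
  there; tangent vectors of unit length have square -1.\<close>

lemma lorentz_orth_nonpos:
  assumes "a \<in> hyp_space" "lorentz u a = 0"
  shows "lorentz u u \<le> 0" and "lorentz u u = 0 \<Longrightarrow> u = 0"
proof -
  have "(snd u * snd a)\<^sup>2 \<le> (norm (fst u))\<^sup>2 * (norm (fst a))\<^sup>2"
    using Cauchy_Schwarz_ineq[of "fst u" "fst a"] assms(2)
    by (simp add: lorentz_def power2_norm_eq_inner)
  then have "(snd u)\<^sup>2 * (1 + (norm (fst a))\<^sup>2) \<le> (norm (fst u))\<^sup>2 * (norm (fst a))\<^sup>2"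
    by (simp add: power_mult_distrib hyp_space_snd[OF assms(1)])
  then have *: "(snd u)\<^sup>2 \<le> ((norm (fst u))\<^sup>2 - (snd u)\<^sup>2) * (norm (fst a))\<^sup>2"
    by (simp add: algebra_simps)
  have eq: "lorentz u u = (snd u)\<^sup>2 - (norm (fst u))\<^sup>2"
    by (simp add: lorentz_def power2_norm_eq_inner power2_eq_square[of "snd u"])
  show "lorentz u u \<le> 0"
  proof (rule ccontr)
    assume "\<not> lorentz u u \<le> 0"
    then have "((norm (fst u))\<^sup>2 - (snd u)\<^sup>2) * (norm (fst a))\<^sup>2 \<le> 0"
      by (intro mult_nonpos_nonneg) (auto simp: eq)
    then have "(snd u)\<^sup>2 \<le> 0" using * by linarith
    then show False using \<open>\<not> lorentz u u \<le> 0\<close> eq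
      by (smt (verit) zero_le_power2)
  qed
  assume "lorentz u u = 0"
  then have "(norm (fst u))\<^sup>2 = (snd u)\<^sup>2" using eq by simp
  with * have "(snd u)\<^sup>2 \<le> 0" by simp
  then have "snd u = 0" by simp
  moreover have "fst u = 0" using \<open>(norm (fst u))\<^sup>2 = (snd u)\<^sup>2\<close> \<open>snd u = 0\<close> by simp
  ultimately show "u = 0" by (simp add: prod_eq_iff)
qed

lemma lorentz_orth_Cauchy_Schwarz:
  assumes "a \<in> hyp_space" "lorentz u a = 0" "lorentz v a = 0"
  shows "(lorentz u v)\<^sup>2 \<le> lorentz u u * lorentz v v"
proof (cases "v = 0")
  case True then show ?thesis by (simp add: lorentz_def)
next
  case False
  define q where "q = - lorentz v v"
  have q: "q > 0" using lorentz_orth_nonpos[OF assms(1,3)] False by (force simp: q_def)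
  \<comment> \<open>Up to the factor \<open>q\<close>, the component of \<open>u\<close> orthogonal
    to \<open>v\<close>.\<close>
  define w where "w = q *\<^sub>R u + lorentz u v *\<^sub>R v"
  have "lorentz w w \<le> 0"
    by (rule lorentz_orth_nonpos(1)[OF assms(1)]) (simp add: w_def assms)
  also have "lorentz w w = q * (q * lorentz u u + (lorentz u v)\<^sup>2)"
    by (simp add: w_def q_def lorentz_commute[of v u] algebra_simps power2_eq_square)
  finally have "q * lorentz u u + (lorentz u v)\<^sup>2 \<le> 0"
    using q by (simp add: mult_le_0_iff)
  then show ?thesis by (simp add: q_def mult.commute)
qed

text \<open>\<open>u\<close> is the component of \<open>y\<close> orthogonal to \<open>x\<close>.
  Negative definiteness bounds its square 1 - (lorentz x y)^2, and a vanishing square forces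
  \<open>u = 0\<close>. The sign of \<open>lorentz x y\<close> comes separately, from both points
  lying on the upper sheet.\<close>

lemma
  assumes "x \<in> hyp_space" "y \<in> hyp_space"
  shows lorentz_ge_1: "lorentz x y \<ge> 1"
    and lorentz_eq_1_iff: "lorentz x y = 1 \<longleftrightarrow> x = y"
proof -
  define u where "u = y - lorentz x y *\<^sub>R x"
  have xx: "lorentz x x = 1" and yy: "lorentz y y = 1"
    using assms by (auto simp: hyp_space_iff)
  have orth: "lorentz u x = 0" by (simp add: u_def xx lorentz_commute)
  have uu: "lorentz u u = 1 - (lorentz x y)\<^sup>2"
    by (simp add: u_def xx yy lorentz_commute[of y x] algebra_simps power2_eq_square)
  have "norm (fst x) * norm (fst y) < snd x * snd y"
    using hyp_space_norm_fst_less[OF assms(1)] hyp_space_norm_fst_less[OF assms(2)]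
    by (intro mult_strict_mono') auto
  then have pos: "lorentz x y > 0"
    using norm_cauchy_schwarz[of "fst x" "fst y"] by (simp add: lorentz_def)
  have "1\<^sup>2 \<le> (lorentz x y)\<^sup>2" using lorentz_orth_nonpos(1)[OF assms(1) orth] uu by simp
  then show "lorentz x y \<ge> 1" using pos by (meson less_imp_le power2_le_imp_le)
  show "lorentz x y = 1 \<longleftrightarrow> x = y"
    using lorentz_orth_nonpos(2)[OF assms(1) orth] uu xx by (auto simp: u_def)
qed

lemma cosh_hyp_dist:
  "x \<in> hyp_space \<Longrightarrow> y \<in> hyp_space \<Longrightarrow> cosh (hyp_dist x y) = lorentz x y"
  using lorentz_ge_1[of x y] by (simp add: hyp_dist_def lorentz_def)

lemma hyp_dist_arcosh: "hyp_dist x y = arcosh (lorentz x y)"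
  by (simp add: hyp_dist_def lorentz_def)

lemma hyp_dist_nonneg: "x \<in> hyp_space \<Longrightarrow> y \<in> hyp_space \<Longrightarrow> hyp_dist x y \<ge> 0"
  by (simp add: hyp_dist_arcosh lorentz_ge_1)

lemma hyp_dist_commute: "hyp_dist x y = hyp_dist y x"
  by (simp add: hyp_dist_arcosh lorentz_commute)

lemma hyp_dist_eq_0_iff:
  "x \<in> hyp_space \<Longrightarrow> y \<in> hyp_space \<Longrightarrow> hyp_dist x y = 0 \<longleftrightarrow> x = y"
  by (simp add: hyp_dist_arcosh lorentz_ge_1 lorentz_eq_1_iff)

lemma hyp_dist_self [simp]: "x \<in> hyp_space \<Longrightarrow> hyp_dist x x = 0"
  by (simp add: hyp_dist_eq_0_iff)

lemma hyp_dist_pos: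
  "x \<in> hyp_space \<Longrightarrow> y \<in> hyp_space \<Longrightarrow> x \<noteq> y \<Longrightarrow> hyp_dist x y > 0"
  using hyp_dist_nonneg hyp_dist_eq_0_iff by (metis order_le_less)

lemma hyp_dist_eqI:
  assumes "lorentz x y = cosh (s - t)" shows "hyp_dist x y = \<bar>s - t\<bar>"
  using assms by (metis arcosh_cosh_real abs_ge_zero cosh_real_abs hyp_dist_arcosh)

lemma lorentz_eq_cosh_iff:
  assumes "x \<in> hyp_space" "y \<in> hyp_space"
  shows "lorentz x y = cosh (s - t) \<longleftrightarrow> hyp_dist x y = \<bar>s - t\<bar>"
  using cosh_hyp_dist[OF assms] hyp_dist_eqI by (metis cosh_real_abs)

text \<open>The components \<open>u\<close>, \<open>v\<close> of \<open>x\<close>, \<open>z\<close>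
  orthogonal to \<open>y\<close> have squares - sinh^2 p and - sinh^2 q, so Cauchy-Schwarz on the
  tangent space at \<open>y\<close> bounds \<open>lorentz x z\<close> by cosh p cosh q + sinh p sinh
  q = cosh (p + q): the law of cosines with the angle estimated away.\<close>

lemma hyp_dist_triangle:
  assumes "x \<in> hyp_space" "y \<in> hyp_space" "z \<in> hyp_space"
  shows "hyp_dist x z \<le> hyp_dist x y + hyp_dist y z"
proof -
  define p q where "p = hyp_dist x y" and "q = hyp_dist y z"
  have p: "cosh p = lorentz x y" "p \<ge> 0" and q: "cosh q = lorentz y z" "q \<ge> 0"
    using assms by (auto simp: p_def q_def cosh_hyp_dist hyp_dist_nonneg)
  have n: "lorentz x x = 1" "lorentz y y = 1" "lorentz z z = 1"
    using assms by (auto simp: hyp_space_iff)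
  define u v where "u = x - cosh p *\<^sub>R y" and "v = z - cosh q *\<^sub>R y"
  have "(lorentz u v)\<^sup>2 \<le> lorentz u u * lorentz v v"
    by (rule lorentz_orth_Cauchy_Schwarz[OF assms(2)])
       (simp_all add: u_def v_def n p q lorentz_commute[of z y])
  moreover have "lorentz u u = 1 - (lorentz x y)\<^sup>2"
    by (simp add: u_def n p lorentz_commute[of y x] algebra_simps power2_eq_square)
  then have "lorentz u u = - (sinh p)\<^sup>2" by (simp flip: p(1) add: cosh_square_eq)
  moreover have "lorentz v v = 1 - (lorentz y z)\<^sup>2"
    by (simp add: v_def n q lorentz_commute[of z y] algebra_simps power2_eq_square)
  then have "lorentz v v = - (sinh q)\<^sup>2" by (simp flip: q(1) add: cosh_square_eq)
  moreover have "lorentz u v = lorentz x z - cosh p * cosh q"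
    by (simp add: u_def v_def n p q algebra_simps)
  ultimately have "(lorentz x z - cosh p * cosh q)\<^sup>2 \<le> (- (sinh p)\<^sup>2) * (- (sinh q)\<^sup>2)"
    by metis
  also have "\<dots> = (sinh p * sinh q)\<^sup>2" by (simp only: power_mult_distrib minus_mult_minus)
  finally have "lorentz x z - cosh p * cosh q \<le> sinh p * sinh q"
    by (rule power2_le_imp_le) (simp add: p q)
  then have "cosh (hyp_dist x z) \<le> cosh (p + q)"
    unfolding cosh_add cosh_hyp_dist[OF assms(1,3)] by linarith
  then have "hyp_dist x z \<le> p + q"
    using p(2) q(2) hyp_dist_nonneg[OF assms(1,3)] by (subst (asm) cosh_real_nonneg_le_iff) auto
  then show ?thesis by (simp add: p_def q_def)
qed

lemma continuous_on_hyp_dist [continuous_intros]: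
  assumes "continuous_on S f" "continuous_on S g"
    "\<And>x. x \<in> S \<Longrightarrow> f x \<in> hyp_space" "\<And>x. x \<in> S \<Longrightarrow> g x \<in> hyp_space"
  shows "continuous_on S (\<lambda>x. hyp_dist (f x) (g x))"
  unfolding hyp_dist_arcosh
  by (rule continuous_on_compose2[OF continuous_on_arcosh[OF order_refl]])
     (auto intro!: continuous_on_lorentz lorentz_ge_1 assms)

text \<open>The open condition \<open>snd x > 0\<close> may be weakened to
  \<open>snd x \<ge> 0\<close>, because a vector of square 1 cannot have time coordinate 0.\<close>

lemma closed_hyp_space: "closed (hyp_space :: ((real ^ 'n) \<times> real) set)"
proof -
  have "x \<in> hyp_space" if x: "snd x \<ge> 0" "lorentz x x = 1" for x :: "(real ^ 'n) \<times> real"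
  proof -
    have "snd x \<noteq> 0"
    proof
      assume "snd x = 0"
      then have "lorentz x x \<le> 0" by (simp add: lorentz_def)
      then show False using x by simp
    qed
    then show "x \<in> hyp_space" using x by (auto simp: hyp_space_iff)
  qed
  then have *: "hyp_space = {x :: (real ^ 'n) \<times> real. snd x \<ge> 0} \<inter> {x. lorentz x x = 1}"
    by (auto simp: hyp_space_iff)
  show ?thesis
    unfolding * by (intro closed_Int closed_Collect_le closed_Collect_eq continuous_intros)
qed

text \<open>The time coordinate is the cosh of the distance from the apex \<open>o'\<close> and
  dominates the space part, so hyperbolically bounded sets are bounded in the ambient norm.\<close>

lemma compact_hyp_cball:
  fixes x :: "(real ^ 'n) \<times> real"
  assumes "x \<in> hyp_space"
  shows "compact {y \<in> hyp_space. hyp_dist x y \<le> R}"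
proof -
  define o' :: "(real ^ 'n) \<times> real" where "o' = (0, 1)"
  have o': "o' \<in> hyp_space" by (simp add: o'_def hyp_space_def)
  have "closed (hyp_space \<inter> hyp_dist x -` {..R})"
    by (rule continuous_closed_preimage) (auto intro!: continuous_intros closed_hyp_space assms)
  then have "closed {y \<in> hyp_space. hyp_dist x y \<le> R}"
    by (simp add: vimage_def Int_def)
  moreover have "norm y \<le> 2 * cosh (hyp_dist o' x + R)"
    if y: "y \<in> hyp_space" "hyp_dist x y \<le> R" for y
  proof -
    have "hyp_dist o' y \<le> hyp_dist o' x + R"
      using hyp_dist_triangle[OF o' assms y(1)] y(2) by simp
    then have "cosh (hyp_dist o' y) \<le> cosh (hyp_dist o' x + R)"
      using hyp_dist_nonneg[OF o' y(1)] by (subst cosh_real_nonneg_le_iff) auto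
    then have "snd y \<le> cosh (hyp_dist o' x + R)"
      using cosh_hyp_dist[OF o' y(1)] by (simp add: lorentz_def o'_def)
    then show ?thesis
      using hyp_space_norm_fst_less[OF y(1)] norm_Pair_le[of "fst y" "snd y"] y(1)
      by (simp add: hyp_space_def)
  qed
  ultimately show ?thesis
    unfolding compact_eq_bounded_closed bounded_iff by auto
qed

text \<open>On the compact set of points within hyperbolic distance 1 but outside the Euclidean
  ball, the distance from \<open>x\<close> has a positive minimum; any smaller radius avoids that
  set.\<close>

lemma hyp_ball_subset_ball:
  assumes "x \<in> hyp_space" "e > 0"
  obtains d where "d > 0" "\<And>y. y \<in> hyp_space \<Longrightarrow> hyp_dist x y < d \<Longrightarrow> dist x y < e"
proof -
  define K where "K = {y \<in> hyp_space. hyp_dist x y \<le> 1} \<inter> - ball x e"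
  have K: "compact K" unfolding K_def
    by (intro compact_Int_closed compact_hyp_cball assms) auto
  show ?thesis
  proof (cases "K = {}")
    case True
    then show ?thesis by (intro that[of 1]) (force simp: K_def)+
  next
    case False
    have "continuous_on K (hyp_dist x)"
      by (intro continuous_intros) (auto simp: K_def assms)
    then obtain z where z: "z \<in> K" "\<And>y. y \<in> K \<Longrightarrow> hyp_dist x z \<le> hyp_dist x y"
      using continuous_attains_inf[OF K False] by blast
    have "hyp_dist x z > 0"
      using z(1) assms by (intro hyp_dist_pos) (auto simp: K_def)
    show ?thesis
    proof (rule that[of "min 1 (hyp_dist x z)"])
      show "dist x y < e" if "y \<in> hyp_space" "hyp_dist x y < min 1 (hyp_dist x z)" for y
        using z(2)[of y] that by (force simp: K_def)
    qed (use \<open>hyp_dist x z > 0\<close> in auto)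
  qed
qed

section \<open>Geodesics\<close>

text \<open>With \<open>a\<close> on the hyperboloid and \<open>b\<close> a unit tangent vector at
  \<open>a\<close> this is the unit-speed geodesic. Leaving \<open>a\<close> and \<open>b\<close>
  unconstrained makes agreement with such a curve a purely linear matter; unit speed is recovered in
  \<open>hyp_line_unit\<close>.\<close>

definition hyp_line :: "(real ^ 'n) \<times> real \<Rightarrow> (real ^ 'n) \<times> real \<Rightarrow> real \<Rightarrow> (real ^ 'n) \<times> real" where
  "hyp_line a b t = cosh t *\<^sub>R a + sinh t *\<^sub>R b"

lemma continuous_on_hyp_line [continuous_intros]: "continuous_on S (hyp_line a b)"
  unfolding hyp_line_def by (intro continuous_intros)

lemma hyp_line_geodesic:
  assumes a: "a \<in> hyp_space" and ab: "lorentz a b = 0" and bb: "lorentz b b = -1"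
  shows "hyp_geodesic_on UNIV (hyp_line a b)"
proof -
  have aa: "lorentz a a = 1" using a by (simp add: hyp_space_iff)
  have *: "lorentz (hyp_line a b s) (hyp_line a b t) = cosh (s - t)" for s t
    by (simp add: hyp_line_def aa ab bb lorentz_commute[of b a] cosh_diff algebra_simps)
  have "lorentz (hyp_line a b t) a = cosh t" for t
    by (simp add: hyp_line_def aa ab lorentz_commute[of b a])
  then have "hyp_line a b t \<in> hyp_space" for t
    using lorentz_pos_imp_snd_pos[of "hyp_line a b t" a] a by (simp add: hyp_space_iff *)
  then show ?thesis
    by (auto simp: hyp_geodesic_on_def * intro: hyp_dist_eqI)
qed

lemma hyp_line_through:
  assumes x: "x \<in> hyp_space" and y: "y \<in> hyp_space" and "x \<noteq> y"
  obtains c where "hyp_geodesic_on UNIV c" "c 0 = x" "c (hyp_dist x y) = y"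
proof -
  define d where "d = hyp_dist x y"
  have d: "d > 0" "lorentz x y = cosh d"
    using assms by (auto simp: d_def hyp_dist_pos cosh_hyp_dist)
  have n: "lorentz x x = 1" "lorentz y y = 1" using x y by (auto simp: hyp_space_iff)
  \<comment> \<open>\<open>b\<close> will be the direction from \<open>x\<close> towards
    \<open>y\<close>: the part of \<open>y\<close> orthogonal to \<open>x\<close> has square 1 -
    cosh^2 d = - sinh^2 d, and \<open>k\<close> normalises it.\<close>
  define k where "k = 1 / sinh d"
  define b where "b = k *\<^sub>R (y - cosh d *\<^sub>R x)"
  have "lorentz b b = k\<^sup>2 * (1 - (cosh d)\<^sup>2)"
    unfolding b_def lorentz_simps n d lorentz_commute[of y x] by algebra
  then have bb: "lorentz b b = -1" using d by (simp add: cosh_square_eq k_def power_divide)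
  have ab: "lorentz x b = 0" by (simp add: b_def n d)
  show ?thesis
  proof (rule that[of "hyp_line x b"])
    show "hyp_line x b (hyp_dist x y) = y"
      using d by (simp add: hyp_line_def b_def k_def d_def[symmetric])
  qed (use hyp_line_geodesic[OF x ab bb] in \<open>auto simp: hyp_line_def\<close>)
qed

text \<open>The vector below is Lorentz-orthogonal to each of \<^term>\<open>x\<close>, \<^term>\<open>y\<close>, \<^term>\<open>z\<close>, hence to itself.\<close>

lemma hyp_collinear:
  assumes x: "x \<in> hyp_space" and y: "y \<in> hyp_space" and z: "z \<in> hyp_space"
    and "hyp_dist x y = \<bar>p - q\<bar>" "hyp_dist y z = \<bar>q - r\<bar>" "hyp_dist x z = \<bar>p - r\<bar>"
  shows "sinh (q - r) *\<^sub>R x + sinh (r - p) *\<^sub>R y + sinh (p - q) *\<^sub>R z = 0"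
proof -
  have l: "lorentz x y = cosh (p - q)" "lorentz y z = cosh (q - r)" "lorentz x z = cosh (p - r)"
    using assms lorentz_eq_cosh_iff by blast+
  have n: "lorentz x x = 1" "lorentz y y = 1" "lorentz z z = 1"
    using x y z by (auto simp: hyp_space_iff)
  define w where "w = sinh (q - r) *\<^sub>R x + sinh (r - p) *\<^sub>R y + sinh (p - q) *\<^sub>R z"
  have id: "sinh (r - p) = - (sinh (p - q) * cosh (q - r) + cosh (p - q) * sinh (q - r))"
    using sinh_add[of "p - q" "q - r"] sinh_minus[of "p - r"] by simp
  have id2: "cosh (p - r) = cosh (p - q) * cosh (q - r) + sinh (p - q) * sinh (q - r)"
    using cosh_add[of "p - q" "q - r"] by simp
  have c: "cosh (p - q) * cosh (p - q) = 1 + sinh (p - q) * sinh (p - q)"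
     "cosh (q - r) * cosh (q - r) = 1 + sinh (q - r) * sinh (q - r)"
    using cosh_square_eq[of "p - q"] cosh_square_eq[of "q - r"] by (auto simp: power2_eq_square)
  have wx: "lorentz w x = 0"
    unfolding w_def lorentz_simps lorentz_commute[of y x] lorentz_commute[of z x] l n id id2
    using c by algebra
  have wy: "lorentz w y = 0"
    unfolding w_def lorentz_simps lorentz_commute[of z y] l n id id2 by algebra
  have wz: "lorentz w z = 0"
    unfolding w_def lorentz_simps l n id id2 using c by algebra
  have "lorentz w w = sinh (q - r) * lorentz w x + sinh (r - p) * lorentz w y + sinh (p - q) * lorentz w z"
    by (subst (2) w_def) simp
  then have "w = 0"
    using lorentz_orth_nonpos(2)[OF y wy] by (simp add: wx wy wz)
  then show ?thesis by (simp add: w_def)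
qed

text \<open>Solves the relation of \<open>hyp_collinear\<close> for \<open>z\<close>. The addition
  formulas separate \<open>r\<close> from the rest, so the coefficients depend on the anchors
  \<open>x\<close>, \<open>y\<close> and their times only, and one line serves every
  \<open>z\<close>.\<close>

lemma hyp_geodesic_interpolate:
  assumes "x \<in> hyp_space" "y \<in> hyp_space" "z \<in> hyp_space" "p \<noteq> q"
    "hyp_dist x y = \<bar>p - q\<bar>" "hyp_dist y z = \<bar>q - r\<bar>" "hyp_dist x z = \<bar>p - r\<bar>"
  shows "z = hyp_line ((1 / sinh (p - q)) *\<^sub>R (sinh p *\<^sub>R y - sinh q *\<^sub>R x))
               ((1 / sinh (p - q)) *\<^sub>R (cosh q *\<^sub>R x - cosh p *\<^sub>R y)) r"
proof -
  have *: "sinh (p - q) *\<^sub>R z = - (sinh (q - r) *\<^sub>R x + sinh (r - p) *\<^sub>R y)"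
    using hyp_collinear[OF assms(1-3,5-7)] by (simp add: add_eq_0_iff)
  have "z = (1 / sinh (p - q)) *\<^sub>R (sinh (p - q) *\<^sub>R z)"
    using assms(4) by simp
  also have "\<dots> = (1 / sinh (p - q)) *\<^sub>R - (sinh (q - r) *\<^sub>R x + sinh (r - p) *\<^sub>R y)"
    unfolding * ..
  also have "\<dots> = hyp_line ((1 / sinh (p - q)) *\<^sub>R (sinh p *\<^sub>R y - sinh q *\<^sub>R x))
               ((1 / sinh (p - q)) *\<^sub>R (cosh q *\<^sub>R x - cosh p *\<^sub>R y)) r"
    unfolding hyp_line_def sinh_diff[of q r] sinh_diff[of r p]
    by (simp add: scaleR_add_left scaleR_diff_left scaleR_add_right scaleR_diff_right mult_ac)
  finally show ?thesis .
qed

text \<open>Two values give a linear system for \<open>a - a'\<close> and \<open>b - b'\<close> with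
  determinant sinh (t - s).\<close>

lemma hyp_line_unique:
  assumes "hyp_line a b s = hyp_line a' b' s" "hyp_line a b t = hyp_line a' b' t" "s \<noteq> t"
  shows "a = a'" "b = b'"
proof -
  have s: "cosh s *\<^sub>R (a - a') + sinh s *\<^sub>R (b - b') = 0"
    and t: "cosh t *\<^sub>R (a - a') + sinh t *\<^sub>R (b - b') = 0"
    using assms(1,2) by (auto simp: hyp_line_def algebra_simps)
  have "sinh (t - s) *\<^sub>R (a - a') =
     sinh t *\<^sub>R (cosh s *\<^sub>R (a - a') + sinh s *\<^sub>R (b - b')) - sinh s *\<^sub>R (cosh t *\<^sub>R (a - a') + sinh t *\<^sub>R (b - b'))"
    by (simp add: sinh_diff algebra_simps)
  then have "sinh (t - s) *\<^sub>R (a - a') = 0" unfolding s t by simp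
  then show "a = a'" using assms(3) by simp
  have "sinh (t - s) *\<^sub>R (b - b') =
     cosh s *\<^sub>R (cosh t *\<^sub>R (a - a') + sinh t *\<^sub>R (b - b')) - cosh t *\<^sub>R (cosh s *\<^sub>R (a - a') + sinh s *\<^sub>R (b - b'))"
    by (simp add: sinh_diff algebra_simps)
  then have "sinh (t - s) *\<^sub>R (b - b') = 0" unfolding s t by simp
  then show "b = b'" using assms(3) by simp
qed

section \<open>Rigidity of geodesics\<close>

text \<open>Near each time interpolation from two anchors writes \<open>c\<close> as a line, and two
  values determine the pair (a, b). So the pair \<open>F t\<close> valid near \<open>t\<close> is
  locally constant in \<open>t\<close>, hence constant, the real line being connected.\<close>

lemma hyp_local_geodesic_is_line:
  assumes "\<And>t. \<exists>e>0. hyp_geodesic_on (ball t e) c"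
  obtains a b where "c = hyp_line a b"
proof -
  have ex: "\<exists>a b e. e > 0 \<and> (\<forall>s\<in>ball t e. c s = hyp_line a b s)" for t
  proof -
    obtain e where e: "e > 0" "hyp_geodesic_on (ball t e) c" using assms by blast
    have in_ball: "t \<in> ball t e" "t + e / 2 \<in> ball t e" using e(1) by (auto simp: dist_real_def)
    have hyp: "c s \<in> hyp_space" if "s \<in> ball t e" for s
      using e(2) that by (auto simp: hyp_geodesic_on_def)
    have "\<exists>a b. \<forall>s\<in>ball t e. c s = hyp_line a b s"
    proof (intro exI ballI)
      fix s assume s: "s \<in> ball t e"
      show "c s = hyp_line
        ((1 / sinh (t - (t + e/2))) *\<^sub>R (sinh t *\<^sub>R c (t + e/2) - sinh (t + e/2) *\<^sub>R c t))
        ((1 / sinh (t - (t + e/2))) *\<^sub>R (cosh (t + e/2) *\<^sub>R c t - cosh t *\<^sub>R c (t + e/2))) s"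
        by (rule hyp_geodesic_interpolate)
           (use hyp in_ball s e in \<open>auto simp: hyp_geodesic_on_def\<close>)
    qed
    then obtain a b where "\<forall>s\<in>ball t e. c s = hyp_line a b s" by (elim exE)
    then show ?thesis using e(1) by (intro exI conjI)
  qed
  define near where "near t f \<longleftrightarrow> (\<exists>e>0. \<forall>s\<in>ball t e. c s = hyp_line (fst f) (snd f) s)" for t f
  define F where "F t = (SOME f. near t f)" for t
  have F: "near t (F t)" for t
  proof -
    from ex[of t] obtain a b e where "e > 0 \<and> (\<forall>s\<in>ball t e. c s = hyp_line a b s)" by (elim exE)
    then have "near t (a, b)" unfolding near_def fst_conv snd_conv by (rule exI)
    then show ?thesis unfolding F_def by (rule someI)
  qed
  have uniq: "f = f'" if "near t f" "near t f'" for t f f'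
  proof -
    from that(1)[unfolded near_def]
    obtain e where e: "e > 0 \<and> (\<forall>s\<in>ball t e. c s = hyp_line (fst f) (snd f) s)" ..
    from that(2)[unfolded near_def]
    obtain e' where e': "e' > 0 \<and> (\<forall>s\<in>ball t e'. c s = hyp_line (fst f') (snd f') s)" ..
    define s where "s = t + min e e' / 2"
    have s: "s \<noteq> t" "s \<in> ball t e" "s \<in> ball t e'"
      using e e' by (auto simp: s_def dist_real_def min_def)
    have eq: "hyp_line (fst f) (snd f) u = hyp_line (fst f') (snd f') u"
      if "u \<in> ball t e" "u \<in> ball t e'" for u
      using e[THEN conjunct2, THEN bspec, OF that(1)] e'[THEN conjunct2, THEN bspec, OF that(2)]
      by (rule trans[OF sym])
    have "t \<in> ball t e" "t \<in> ball t e'" using e e' by auto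
    from hyp_line_unique[OF eq[OF this] eq[OF s(2,3)] s(1)[symmetric]]
    show ?thesis by (rule prod_eqI)
  qed
  have "F constant_on UNIV"
  proof (rule locally_constant_imp_constant)
    fix t :: real
    from F[of t, unfolded near_def]
    obtain e where e: "e > 0 \<and> (\<forall>s\<in>ball t e. c s = hyp_line (fst (F t)) (snd (F t)) s)" ..
    have const: "F s = F t" if st: "s \<in> ball t e" for s
    proof (rule uniq[OF F])
      obtain d where d: "d > 0" "ball s d \<subseteq> ball t e"
        by (rule openE[OF open_ball st])
      have "\<forall>u\<in>ball s d. c u = hyp_line (fst (F t)) (snd (F t)) u"
        using e[THEN conjunct2, THEN bspec, OF subsetD[OF d(2)]] by (intro ballI)
      with d(1) show "near s (F t)" unfolding near_def by (intro exI[of _ d] conjI)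
    qed
    have "t \<in> ball t e" using e by simp
    then show "\<exists>T. openin (top_of_set UNIV) T \<and> t \<in> T \<and> (\<forall>x\<in>T. F x = F t)"
      by (intro exI[of _ "ball t e"] conjI ballI const) (auto simp: open_openin[symmetric])
  qed auto
  then obtain f where "\<And>t. F t = f" by (auto simp: constant_on_def)
  then have "c t = hyp_line (fst f) (snd f) t" for t
    using F[of t] unfolding near_def by auto
  then show ?thesis by (intro that) auto
qed

text \<open>A single small \<open>s > 0\<close> suffices: its distance from time 0 forces
  \<open>b\<close> to be orthogonal to \<open>a\<close>, and then the hyperboloid equation at
  \<open>s\<close> forces \<open>lorentz b b = -1\<close>.\<close>

lemma hyp_line_unit:
  assumes "range (hyp_line a b) \<subseteq> hyp_space"
    and "e > 0" "\<And>s. s \<in> ball 0 e \<Longrightarrow> hyp_dist (hyp_line a b 0) (hyp_line a b s) = \<bar>s\<bar>"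
  shows "hyp_geodesic_on UNIV (hyp_line a b)"
proof -
  have "hyp_line a b 0 \<in> hyp_space" using assms(1) by blast
  then have a: "a \<in> hyp_space" by (simp add: hyp_line_def)
  then have aa: "lorentz a a = 1" by (simp add: hyp_space_iff)
  define s where "s = e / 2"
  have s: "s > 0" "s \<in> ball 0 e" using assms by (auto simp: s_def dist_real_def)
  have h: "hyp_line a b s \<in> hyp_space" using assms(1) by blast
  have "lorentz a (hyp_line a b s) = cosh s"
    using lorentz_eq_cosh_iff[OF a h, of 0 s] assms(3)[OF s(2)] by (simp add: hyp_line_def)
  then have ab: "lorentz a b = 0" using s(1) by (simp add: hyp_line_def aa)
  have "(cosh s)\<^sup>2 + (sinh s)\<^sup>2 * lorentz b b = 1"
    using h by (simp add: hyp_space_iff hyp_line_def aa ab lorentz_commute[of b a] power2_eq_square)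
  then have "(sinh s)\<^sup>2 * (lorentz b b + 1) = 0" by (simp add: cosh_square_eq algebra_simps)
  then have "lorentz b b = -1" using s(1) by simp
  then show ?thesis by (rule hyp_line_geodesic[OF a ab])
qed

lemma hyp_local_geodesic_imp_geodesic:
  assumes "\<And>t. \<exists>e>0. hyp_geodesic_on (ball t e) c"
  shows "hyp_geodesic_on UNIV c"
proof -
  obtain a b where c: "c = hyp_line a b" using hyp_local_geodesic_is_line assms by blast
  obtain e where e: "e > 0" "hyp_geodesic_on (ball 0 e) c" using assms by blast
  have "c t \<in> hyp_space" for t
    using assms[of t] by (force simp: hyp_geodesic_on_def)
  then show ?thesis
    unfolding c by (intro hyp_line_unit[OF _ e(1)]) (use e in \<open>auto simp: c hyp_geodesic_on_def\<close>)
qed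

lemma hyp_geodesic_UNIV_eqI:
  assumes "hyp_geodesic_on UNIV c" "hyp_geodesic_on UNIV c'" "c s = c' s" "c t = c' t" "s \<noteq> t"
  shows "c = c'"
proof -
  obtain a b a' b' where "c = hyp_line a b" "c' = hyp_line a' b'"
    using hyp_local_geodesic_is_line[of c] hyp_local_geodesic_is_line[of c'] assms(1,2)
    unfolding hyp_geodesic_on_def by (metis UNIV_I image_subset_iff zero_less_one)
  then show ?thesis using hyp_line_unique assms by metis
qed

text \<open>\<open>z\<close> and \<open>c r\<close> are interpolated from the same anchors
  \<open>c s\<close> and \<open>c t\<close> by the same formula. The time \<open>r\<close> may lie
  outside the interval between \<open>s\<close> and \<open>t\<close>, so a segment can be
  prolonged.\<close>

lemma hyp_geodesic_extend:
  assumes "hyp_geodesic_on UNIV c" "z \<in> hyp_space" "s \<noteq> t"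
    "hyp_dist (c s) z = \<bar>s - r\<bar>" "hyp_dist (c t) z = \<bar>t - r\<bar>"
  shows "z = c r"
proof -
  have c: "c x \<in> hyp_space" "hyp_dist (c x) (c y) = \<bar>x - y\<bar>" for x y
    using assms(1) by (auto simp: hyp_geodesic_on_def)
  show ?thesis
    using hyp_geodesic_interpolate[OF c(1)[of s] c(1)[of t] assms(2,3) c(2) assms(5,4)]
      hyp_geodesic_interpolate[OF c(1)[of s] c(1)[of t] c(1)[of r] assms(3) c(2) c(2) c(2)] by simp
qed

lemma hyp_geodesic_on_continuous:
  assumes "hyp_geodesic_on UNIV c" shows "continuous_on S c"
proof -
  have "\<exists>a b. c = hyp_line a b"
    using hyp_local_geodesic_is_line[of c] assms
    unfolding hyp_geodesic_on_def by (metis UNIV_I image_subset_iff zero_less_one)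
  then show ?thesis by (auto intro: continuous_on_hyp_line)
qed

section \<open>Word norms and divisibility\<close>

lemma (in group) foldr_mult_closed:
  "set w \<subseteq> carrier G \<Longrightarrow> foldr (\<lambda>x y. x \<otimes> y) w \<one> \<in> carrier G"
  by (induction w) auto

lemma (in group) foldr_mult_append:
  assumes "set v \<subseteq> carrier G" "set w \<subseteq> carrier G"
  shows "foldr (\<lambda>x y. x \<otimes> y) (v @ w) \<one> = foldr (\<lambda>x y. x \<otimes> y) v \<one> \<otimes> foldr (\<lambda>x y. x \<otimes> y) w \<one>"
  using assms
proof (induction v)
  case (Cons a v)
  then show ?case using foldr_mult_closed[of v] foldr_mult_closed[of w] by (simp add: m_assoc)
qed (use foldr_mult_closed[of w] in simp)

lemma (in group) generate_imp_word:
  assumes "S \<subseteq> carrier G" "g \<in> generate G S"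
  shows "\<exists>w. set w \<subseteq> S \<union> (\<lambda>s. inv s) ` S \<and> foldr (\<lambda>x y. x \<otimes> y) w \<one> = g"
  using assms(2)
proof (induction rule: generate.induct)
  case one
  then show ?case by (intro exI[of _ "[]"]) auto
next
  case (incl h)
  then show ?case using assms(1) by (intro exI[of _ "[h]"]) auto
next
  case (inv h)
  then show ?case using assms(1) by (intro exI[of _ "[inv h]"]) auto
next
  case (eng g h)
  then obtain v w where vw: "set v \<subseteq> S \<union> (\<lambda>s. inv s) ` S" "foldr (\<lambda>x y. x \<otimes> y) v \<one> = g"
     "set w \<subseteq> S \<union> (\<lambda>s. inv s) ` S" "foldr (\<lambda>x y. x \<otimes> y) w \<one> = h" by blast
  have "S \<union> (\<lambda>s. inv s) ` S \<subseteq> carrier G" using assms(1) by auto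
  then show ?case
    using vw foldr_mult_append[of v w] by (intro exI[of _ "v @ w"]) auto
qed

lemma (in group) word_norm_attained:
  assumes "S \<subseteq> carrier G" "g \<in> generate G S"
  obtains w where "length w = word_norm G S g" "set w \<subseteq> S \<union> (\<lambda>s. inv s) ` S"
    "foldr (\<lambda>x y. x \<otimes> y) w \<one> = g"
proof -
  have "\<exists>k w. length w = k \<and> set w \<subseteq> S \<union> (\<lambda>s. inv s) ` S \<and> foldr (\<lambda>x y. x \<otimes> y) w \<one> = g"
    using generate_imp_word[OF assms] by blast
  from LeastI_ex[OF this] show ?thesis
    using that unfolding word_norm_def by blast
qed

lemma word_norm_le_length:
  "set w \<subseteq> S \<union> (\<lambda>s. inv\<^bsub>G\<^esub> s) ` S \<Longrightarrow>
    word_norm G S (foldr (\<lambda>x y. x \<otimes>\<^bsub>G\<^esub> y) w \<one>\<^bsub>G\<^esub>) \<le> length w"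
  unfolding word_norm_def by (rule Least_le) blast

lemma (in group) word_norm_mult_le:
  assumes "S \<subseteq> carrier G" "g \<in> generate G S" "h \<in> generate G S"
  shows "word_norm G S (g \<otimes> h) \<le> word_norm G S g + word_norm G S h"
proof -
  obtain v where v: "length v = word_norm G S g" "set v \<subseteq> S \<union> (\<lambda>s. inv s) ` S"
    "foldr (\<lambda>x y. x \<otimes> y) v \<one> = g" using word_norm_attained assms by blast
  obtain w where w: "length w = word_norm G S h" "set w \<subseteq> S \<union> (\<lambda>s. inv s) ` S"
    "foldr (\<lambda>x y. x \<otimes> y) w \<one> = h" using word_norm_attained assms by blast
  have "S \<union> (\<lambda>s. inv s) ` S \<subseteq> carrier G" using assms(1) by auto
  then have "foldr (\<lambda>x y. x \<otimes> y) (v @ w) \<one> = g \<otimes> h"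
    using v w foldr_mult_append[of v w] by auto
  then show ?thesis
    using word_norm_le_length[of "v @ w" S G] v w by simp
qed

section \<open>Divisibility under automorphisms\<close>

lemma (in group) rcosets_iso_image:
  assumes \<phi>: "\<phi> \<in> iso G G" and H: "H \<subseteq> carrier G"
  shows "rcosets (\<phi> ` H) = image \<phi> ` (rcosets H)"
proof -
  have coset: "K #> a = (\<lambda>h. h \<otimes> a) ` K" for K a
    by (auto simp: r_coset_def)
  have hom: "\<phi> (h \<otimes> a) = \<phi> h \<otimes> \<phi> a" if "h \<in> H" "a \<in> carrier G" for h a
    using \<phi> H that by (intro hom_mult[of \<phi> G G]) (auto simp: iso_def)
  have "\<phi> ` (H #> a) = \<phi> ` H #> \<phi> a" if "a \<in> carrier G" for a
    unfolding coset image_image by (intro image_cong refl hom that)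
  then have "image \<phi> ` (rcosets H) = (\<lambda>b. \<phi> ` H #> b) ` (\<phi> ` carrier G)"
    unfolding RCOSETS_def image_UN image_insert image_empty UNION_singleton_eq_range image_image
    by (intro image_cong refl)
  also have "\<phi> ` carrier G = carrier G"
    using \<phi> by (simp add: iso_def bij_betw_def)
  finally show ?thesis
    by (simp add: RCOSETS_def UNION_singleton_eq_range)
qed

lemma (in group) subgroup_index_iso_image:
  assumes \<phi>: "\<phi> \<in> iso G G" and H: "subgroup H G"
  shows "subgroup_index G (\<phi> ` H) = subgroup_index G H"
proof -
  have "H \<subseteq> carrier G" using H by (rule subgroup.subset)
  have "inj_on (image \<phi>) (Pow (carrier G))"
    using \<phi> by (intro inj_on_image_Pow) (simp add: iso_def bij_betw_def)
  moreover have "rcosets H \<subseteq> Pow (carrier G)"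
    using rcosets_part_G[OF H] by blast
  ultimately have "inj_on (image \<phi>) (rcosets H)" by (rule inj_on_subset)
  then show ?thesis
    unfolding subgroup_index_def rcosets_iso_image[OF \<phi> \<open>H \<subseteq> carrier G\<close>]
    by (simp add: card_image finite_image_iff)
qed

text \<open>Taking images under \<open>\<phi>\<close> preserves the index and turns subgroups that
  miss \<open>g\<close> into subgroups that miss \<open>\<phi> g\<close>, so the infimum for
  \<open>\<phi> g\<close> runs over at least the same indices.\<close>

lemma (in group) divisibility_iso_le:
  assumes \<phi>: "\<phi> \<in> iso G G" and g: "g \<in> carrier G"
  shows "divisibility G (\<phi> g) \<le> divisibility G g"
  unfolding divisibility_def
proof (rule Inf_superset_mono, clarify)
  fix H assume H: "subgroup H G" "g \<notin> H"
  interpret h: group_hom G G \<phi>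
    using \<phi> by unfold_locales (auto simp: iso_def)
  have "\<phi> g \<notin> \<phi> ` H"
    using \<phi> H g subgroup.subset[OF H(1)] unfolding iso_def bij_betw_def
    by (auto dest: inj_onD)
  then show "\<exists>H'. subgroup_index G H = subgroup_index G H' \<and> subgroup H' G \<and> \<phi> g \<notin> H'"
    using subgroup_index_iso_image[OF \<phi> H(1)] h.subgroup_img_is_subgroup[OF H(1)]
    by (intro exI[of _ "\<phi> ` H"]) auto
qed

lemma (in group) cancel_inv:
  "h \<in> carrier G \<Longrightarrow> x \<in> carrier G \<Longrightarrow> inv h \<otimes> (h \<otimes> x) = x"
  "h \<in> carrier G \<Longrightarrow> x \<in> carrier G \<Longrightarrow> h \<otimes> (inv h \<otimes> x) = x"
  by (simp_all flip: m_assoc)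

lemma (in group) conjugation_iso:
  assumes "h \<in> carrier G" shows "(\<lambda>x. h \<otimes> x \<otimes> inv h) \<in> iso G G"
proof -
  have "h \<otimes> (x \<otimes> y) \<otimes> inv h = h \<otimes> x \<otimes> inv h \<otimes> (h \<otimes> y \<otimes> inv h)"
    if "x \<in> carrier G" "y \<in> carrier G" for x y
    using assms that by (simp add: m_assoc cancel_inv)
  then have "(\<lambda>x. h \<otimes> x \<otimes> inv h) \<in> hom G G"
    using assms by (auto simp: hom_def)
  moreover have "bij_betw (\<lambda>x. h \<otimes> x \<otimes> inv h) (carrier G) (carrier G)"
    by (rule bij_betwI[where g = "\<lambda>x. inv h \<otimes> x \<otimes> h"])
       (use assms in \<open>auto simp: m_assoc cancel_inv\<close>)
  ultimately show ?thesis by (simp add: iso_def)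
qed

lemma (in group) conjugate_eq_one_iff:
  assumes "g \<in> carrier G" "h \<in> carrier G"
  shows "h \<otimes> g \<otimes> inv h = \<one> \<longleftrightarrow> g = \<one>"
proof
  assume "h \<otimes> g \<otimes> inv h = \<one>"
  then have "inv h \<otimes> (h \<otimes> g \<otimes> inv h) \<otimes> h = \<one>" using assms by simp
  then show "g = \<one>" using assms by (simp add: m_assoc cancel_inv)
qed (use assms in simp)

lemma (in group) divisibility_conjugate:
  assumes "g \<in> carrier G" "h \<in> carrier G"
  shows "divisibility G (h \<otimes> g \<otimes> inv h) = divisibility G g"
proof (rule antisym)
  show "divisibility G (h \<otimes> g \<otimes> inv h) \<le> divisibility G g"
    using divisibility_iso_le[OF conjugation_iso[OF assms(2)] assms(1)] .
  \<comment> \<open>Conjugation by \<open>inv h\<close> leads back to \<open>g\<close>, so the same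
    inequality gives the other direction.\<close>
  have "inv h \<otimes> (h \<otimes> g \<otimes> inv h) \<otimes> inv (inv h) = g"
    using assms by (simp add: m_assoc cancel_inv)
  then show "divisibility G g \<le> divisibility G (h \<otimes> g \<otimes> inv h)"
    using divisibility_iso_le[OF conjugation_iso[of "inv h"], of "h \<otimes> g \<otimes> inv h"] assms by simp
qed

text \<open>Matches the convention that an empty maximum is 1: in \<open>max_or_one_mono\<close> an
  empty set on the left then stays below every nonempty set of divisibilities on the right.\<close>

lemma divisibility_ge_1: "1 \<le> divisibility G g"
  unfolding divisibility_def
proof (rule Inf_greatest, clarify)
  fix H assume "subgroup H G"
  then have "H #>\<^bsub>G\<^esub> \<one>\<^bsub>G\<^esub> \<in> rcosets\<^bsub>G\<^esub> H \<or> carrier G = {}"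
    by (auto simp: RCOSETS_def dest: subgroup.subset subgroup.one_closed)
  moreover have "\<one>\<^bsub>G\<^esub> \<in> carrier G"
    using \<open>subgroup H G\<close> subgroup.subset subgroup.one_closed by blast
  ultimately have "card (rcosets\<^bsub>G\<^esub> H) \<ge> 1" if "finite (rcosets\<^bsub>G\<^esub> H)"
    using that by (auto simp: Suc_le_eq card_gt_0_iff)
  then show "1 \<le> subgroup_index G H"
    by (auto simp: subgroup_index_def one_enat_def)
qed

section \<open>Comparing residual finiteness functions\<close>

lemma max_or_one_mono:
  assumes "\<And>a. a \<in> A \<Longrightarrow> \<exists>b\<in>B. a \<le> b" "\<And>b. b \<in> B \<Longrightarrow> 1 \<le> b"
  shows "max_or_one A \<le> max_or_one B"
proof (cases "A = {}")
  case True
  have "1 \<le> Sup B" if "B \<noteq> {}"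
    using that assms(2) by (meson Sup_upper2 ex_in_conv)
  then show ?thesis using True by (simp add: max_or_one_def)
next
  case False
  then have "B \<noteq> {}" using assms(1) by blast
  then show ?thesis using False assms(1) by (simp add: max_or_one_def Sup_mono)
qed

text \<open>Rescaling the argument does all the work; the outer factor is harmless because
  \<open>K \<ge> 1\<close>.\<close>

lemma growth_leI:
  assumes "K \<ge> 1" "\<And>n. n > 0 \<Longrightarrow> f n \<le> g (K * n)"
  shows "growth_le f g"
  unfolding growth_le_def
proof (intro exI[of _ K] conjI allI impI)
  fix n :: real assume "n > 0"
  have "ereal_of_enat (f n) \<le> 1 * ereal_of_enat (g (K * n))"
    using assms(2)[OF \<open>n > 0\<close>] by simp
  also have "\<dots> \<le> ereal K * ereal_of_enat (g (K * n))"
    using assms(1) by (intro ereal_mult_right_mono) (auto simp: one_ereal_def)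
  finally show "ereal_of_enat (f n) \<le> ereal K * ereal_of_enat (g (K * n))" .
qed (use assms(1) in auto)

text \<open>The hypotheses are not symmetric: a short word bounds the length of the element itself,
  while a small length bounds the word norm of some conjugate only. Conjugates have equal
  divisibility, so this is enough.\<close>

lemma (in group) growth_equiv_of_length:
  fixes len :: "'a \<Rightarrow> real"
  assumes K: "K \<ge> 1"
    and le: "\<And>g. g \<in> carrier G - {\<one>} \<Longrightarrow> len g \<le> K * real (word_norm G S g)"
    and conj: "\<And>g. g \<in> carrier G - {\<one>} \<Longrightarrow>
       \<exists>h\<in>carrier G. real (word_norm G S (h \<otimes> g \<otimes> inv h)) \<le> K * len g"
  shows "growth_equiv (residual_finiteness G S)
     (\<lambda>r. max_or_one (divisibility G ` {g \<in> carrier G - {\<one>}. len g \<le> r}))"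
  unfolding growth_equiv_def
proof
  show "growth_le (residual_finiteness G S)
     (\<lambda>r. max_or_one (divisibility G ` {g \<in> carrier G - {\<one>}. len g \<le> r}))"
  proof (rule growth_leI[OF K], unfold residual_finiteness_def, rule max_or_one_mono)
    fix n :: real and a assume "n > 0"
      and "a \<in> divisibility G ` {g \<in> carrier G - {\<one>}. real (word_norm G S g) \<le> n}"
    then obtain g where g: "g \<in> carrier G - {\<one>}" "real (word_norm G S g) \<le> n" "a = divisibility G g"
      by blast
    have "len g \<le> K * n"
      using le[OF g(1)] g(2) K by (meson mult_left_mono order_trans zero_le_one)
    then show "\<exists>b\<in>divisibility G ` {g \<in> carrier G - {\<one>}. len g \<le> K * n}. a \<le> b"
      using g by blast
  qed (auto simp: divisibility_ge_1)
  show "growth_le (\<lambda>r. max_or_one (divisibility G ` {g \<in> carrier G - {\<one>}. len g \<le> r}))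
      (residual_finiteness G S)"
  proof (rule growth_leI[OF K], unfold residual_finiteness_def, rule max_or_one_mono)
    fix n :: real and a assume "n > 0"
      and "a \<in> divisibility G ` {g \<in> carrier G - {\<one>}. len g \<le> n}"
    then obtain g where g: "g \<in> carrier G - {\<one>}" "len g \<le> n" "a = divisibility G g"
      by blast
    obtain h where h: "h \<in> carrier G" "real (word_norm G S (h \<otimes> g \<otimes> inv h)) \<le> K * len g"
      using conj[OF g(1)] by blast
    have "K * len g \<le> K * n" using g(2) K by (intro mult_left_mono) auto
    moreover have "h \<otimes> g \<otimes> inv h \<noteq> \<one>"
      using g(1) h(1) by (simp add: conjugate_eq_one_iff)
    ultimately have "h \<otimes> g \<otimes> inv h \<in> {g \<in> carrier G - {\<one>}. real (word_norm G S g) \<le> K * n}"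
      using g h by auto
    moreover have "a = divisibility G (h \<otimes> g \<otimes> inv h)"
      using g h divisibility_conjugate by simp
    ultimately show "\<exists>b\<in>divisibility G ` {g \<in> carrier G - {\<one>}. real (word_norm G S g) \<le> K * n}. a \<le> b"
      by blast
  qed (auto simp: divisibility_ge_1)
qed

section \<open>Cobounded proper actions\<close>

text \<open>The setting of the Svarc--Milnor lemma for a pseudometric \<open>d\<close>.
  Coboundedness and properness are asked of the orbit of \<open>x0\<close> only; geodesics enter
  later, through a chain hypothesis.\<close>

locale cobounded_action = group G for G (structure) +
  fixes X :: "'b set" and d :: "'b \<Rightarrow> 'b \<Rightarrow> real" and act :: "'a \<Rightarrow> 'b \<Rightarrow> 'b" and x0 :: 'b
  assumes x0: "x0 \<in> X"
    and d_nonneg: "x \<in> X \<Longrightarrow> y \<in> X \<Longrightarrow> 0 \<le> d x y"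
    and d_self: "x \<in> X \<Longrightarrow> d x x = 0"
    and d_commute: "x \<in> X \<Longrightarrow> y \<in> X \<Longrightarrow> d x y = d y x"
    and d_triangle: "x \<in> X \<Longrightarrow> y \<in> X \<Longrightarrow> z \<in> X \<Longrightarrow> d x z \<le> d x y + d y z"
    and act_closed: "g \<in> carrier G \<Longrightarrow> x \<in> X \<Longrightarrow> act g x \<in> X"
    and act_one: "x \<in> X \<Longrightarrow> act \<one> x = x"
    and act_mult: "g \<in> carrier G \<Longrightarrow> h \<in> carrier G \<Longrightarrow> x \<in> X \<Longrightarrow> act (g \<otimes> h) x = act g (act h x)"
    and act_isometry: "g \<in> carrier G \<Longrightarrow> x \<in> X \<Longrightarrow> y \<in> X \<Longrightarrow> d (act g x) (act g y) = d x y"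
    and cobounded: "\<exists>D. \<forall>x\<in>X. \<exists>g\<in>carrier G. d x (act g x0) \<le> D"
    and proper: "finite {g \<in> carrier G. d x0 (act g x0) \<le> R}"
begin

lemma d_act_inv:
  assumes "g \<in> carrier G" "x \<in> X" "y \<in> X"
  shows "d (act (inv g) x) y = d x (act g y)"
proof -
  have "d (act g (act (inv g) x)) (act g y) = d (act (inv g) x) y"
    using assms by (intro act_isometry) (auto simp: act_closed)
  then show ?thesis using assms by (simp add: act_one flip: act_mult)
qed

lemma displacement_le_word_norm:
  assumes "finite S" "S \<subseteq> carrier G" "generate G S = carrier G"
  obtains K where "K \<ge> 0" "\<And>g. g \<in> carrier G \<Longrightarrow> d x0 (act g x0) \<le> K * real (word_norm G S g)"
proof -
  \<comment> \<open>A sum in place of a maximum bounds each generator and needs no case for empty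
    \<open>S\<close>.\<close>
  define K where "K = (\<Sum>s\<in>S. d x0 (act s x0))"
  have dn: "0 \<le> d x0 (act s x0)" if "s \<in> carrier G" for s
    using that by (simp add: d_nonneg x0 act_closed)
  have gen: "d x0 (act s x0) \<le> K" if "s \<in> S \<union> (\<lambda>s. inv s) ` S" for s
  proof -
    have *: "d x0 (act s x0) \<le> K" if "s \<in> S" for s
      unfolding K_def using that assms dn by (intro member_le_sum) auto
    moreover have "d x0 (act (inv s) x0) = d x0 (act s x0)" if "s \<in> S" for s
      using that assms x0 d_act_inv[of s x0 x0] by (simp add: d_commute[of x0] act_closed subset_iff)
    ultimately show ?thesis using that by auto
  qed
  have word: "d x0 (act (foldr (\<lambda>x y. x \<otimes> y) w \<one>) x0) \<le> K * real (length w)"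
    if "set w \<subseteq> S \<union> (\<lambda>s. inv s) ` S" for w
    using that
  proof (induction w)
    case Nil then show ?case by (simp add: act_one x0 d_self)
  next
    case (Cons a w)
    let ?g = "foldr (\<lambda>x y. x \<otimes> y) w \<one>"
    have a: "a \<in> carrier G" "set w \<subseteq> carrier G" using Cons.prems assms(2) by auto
    then have g: "?g \<in> carrier G" by (intro foldr_mult_closed)
    have "d x0 (act (a \<otimes> ?g) x0) \<le> d x0 (act a x0) + d (act a x0) (act (a \<otimes> ?g) x0)"
      using a g x0 by (intro d_triangle act_closed) auto
    also have "d (act a x0) (act (a \<otimes> ?g) x0) = d x0 (act ?g x0)"
      using a g x0 by (simp add: act_mult act_isometry act_closed)
    also have "d x0 (act a x0) + d x0 (act ?g x0) \<le> K + K * real (length w)"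
      using gen[of a] Cons by (intro add_mono) auto
    finally show ?case by (simp add: algebra_simps)
  qed
  show ?thesis
  proof (rule that)
    show "K \<ge> 0" unfolding K_def using assms dn by (intro sum_nonneg) auto
    show "d x0 (act g x0) \<le> K * real (word_norm G S g)" if "g \<in> carrier G" for g
      using word_norm_attained[of S g] word assms that by metis
  qed
qed

text \<open>One half of the Svarc--Milnor lemma: coarse chains stand in for geodesics.\<close>

lemma word_norm_le_displacement:
  assumes S: "S \<subseteq> carrier G" "generate G S = carrier G"
    and chain: "\<And>y. y \<in> X \<Longrightarrow> \<exists>f. f 0 = x0 \<and> f (nat \<lceil>d x0 y\<rceil>) = y \<and>
       (\<forall>i. f i \<in> X \<and> d (f i) (f (Suc i)) \<le> 1)"
  obtains A where "A \<ge> 0" "\<And>g. g \<in> carrier G \<Longrightarrow> real (word_norm G S g) \<le> A * (d x0 (act g x0) + 1)"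
proof -
  obtain D where D: "\<And>x. x \<in> X \<Longrightarrow> \<exists>g\<in>carrier G. d x (act g x0) \<le> D"
    using cobounded by blast
  have "D \<ge> 0" using D[OF x0] d_nonneg x0 act_closed by (meson order_trans)
  \<comment> \<open>Consecutive chain points are at most 1 apart and each has an orbit point within
    \<open>D\<close>, so consecutive orbit points are at most \<open>2 * D + 1\<close>
    apart.\<close>
  define T where "T = {g \<in> carrier G. d x0 (act g x0) \<le> 2 * D + 1}"
  define A where "A = (\<Sum>t\<in>T. real (word_norm G S t))"
  have A: "real (word_norm G S t) \<le> A" if "t \<in> T" for t
    unfolding A_def using that proper by (intro member_le_sum) (auto simp: T_def)
  have "A \<ge> 0" unfolding A_def by (intro sum_nonneg) auto
  have "real (word_norm G S g) \<le> 2 * A * (d x0 (act g x0) + 1)" if g: "g \<in> carrier G" for g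
  proof -
    define k where "k = nat \<lceil>d x0 (act g x0)\<rceil>"
    have dg: "d x0 (act g x0) \<ge> 0" using g by (simp add: d_nonneg x0 act_closed)
    obtain f where f: "f 0 = x0" "f k = act g x0" "\<And>i. f i \<in> X" "\<And>i. d (f i) (f (Suc i)) \<le> 1"
      using chain[OF act_closed[OF g x0]] unfolding k_def by blast
    \<comment> \<open>\<open>Suc i\<close> and not \<open>i\<close>: over \<open>f 0 = x0\<close>
      the nearby element \<open>h\<close> need not be the identity and already costs one element of
      \<open>T\<close>.\<close>
    have "real (word_norm G S h) \<le> A * real (Suc i)" if "h \<in> carrier G" "d (f i) (act h x0) \<le> D" for i h
      using that
    proof (induction i arbitrary: h)
      case 0
      then have "h \<in> T" using \<open>D \<ge> 0\<close> by (simp add: T_def f)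
      then show ?case using A by simp
    next
      case (Suc i)
      obtain h' where h': "h' \<in> carrier G" "d (f i) (act h' x0) \<le> D" using D f(3) by blast
      have X: "act h x0 \<in> X" "act h' x0 \<in> X" using Suc.prems h' by (auto simp: act_closed x0)
      have "d (act h' x0) (act h x0) \<le> d (act h' x0) (f (Suc i)) + d (f (Suc i)) (act h x0)"
        using X f by (intro d_triangle) auto
      also have "d (act h' x0) (f (Suc i)) \<le> d (act h' x0) (f i) + d (f i) (f (Suc i))"
        using X f by (intro d_triangle) auto
      finally have "d (act h' x0) (act h x0) \<le> 2 * D + 1"
        using h'(2) Suc.prems(2) f(4)[of i] d_commute[OF X(2) f(3)[of i]] by linarith
      moreover have "d (act h' x0) (act h x0) = d x0 (act (inv h' \<otimes> h) x0)"
        using d_act_inv[of "inv h'" x0 "act h x0"] h' Suc.prems X x0 by (simp add: act_mult)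
      ultimately have "inv h' \<otimes> h \<in> T" using h' Suc.prems by (simp add: T_def)
      have "real (word_norm G S (h' \<otimes> (inv h' \<otimes> h))) \<le> real (word_norm G S h') + real (word_norm G S (inv h' \<otimes> h))"
        using word_norm_mult_le[OF S(1), of h' "inv h' \<otimes> h"] h' Suc.prems S(2) by simp
      also have "h' \<otimes> (inv h' \<otimes> h) = h"
        using h' Suc.prems by (simp flip: m_assoc)
      finally show ?case
        using Suc.IH[OF h'] A[OF \<open>inv h' \<otimes> h \<in> T\<close>] by (simp add: algebra_simps)
    qed
    from this[OF g, of k] have "real (word_norm G S g) \<le> A * (real k + 1)"
      using \<open>D \<ge> 0\<close> f d_self act_closed g x0 by (simp add: add.commute)
    also have "\<dots> \<le> A * (2 * (d x0 (act g x0) + 1))"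
      using \<open>A \<ge> 0\<close> dg by (intro mult_left_mono) (auto simp: k_def, linarith)
    finally show ?thesis by (simp add: mult_ac)
  qed
  then show ?thesis using that[of "2 * A"] \<open>A \<ge> 0\<close> by simp
qed

theorem growth_equiv_translation_length:
  fixes len :: "'a \<Rightarrow> real"
  assumes S: "finite S" "S \<subseteq> carrier G" "generate G S = carrier G"
    and chain: "\<And>y. y \<in> X \<Longrightarrow> \<exists>f. f 0 = x0 \<and> f (nat \<lceil>d x0 y\<rceil>) = y \<and>
       (\<forall>i. f i \<in> X \<and> d (f i) (f (Suc i)) \<le> 1)"
    and pos: "\<And>g. g \<in> carrier G - {\<one>} \<Longrightarrow> len g > 0"
    and conj: "\<And>g h. g \<in> carrier G - {\<one>} \<Longrightarrow> h \<in> carrier G \<Longrightarrow> len (h \<otimes> g \<otimes> inv h) = len g"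
    and le: "\<And>g. g \<in> carrier G - {\<one>} \<Longrightarrow> len g \<le> d x0 (act g x0)"
    and att: "\<And>g. g \<in> carrier G - {\<one>} \<Longrightarrow> \<exists>x\<in>X. d x (act g x) \<le> len g"
  shows "growth_equiv (residual_finiteness G S)
     (\<lambda>r. max_or_one (divisibility G ` {g \<in> carrier G - {\<one>}. len g \<le> r}))"
proof -
  obtain D where D: "\<And>x. x \<in> X \<Longrightarrow> \<exists>g\<in>carrier G. d x (act g x0) \<le> D"
    using cobounded by blast
  have "D \<ge> 0" using D[OF x0] d_nonneg x0 act_closed by (meson order_trans)
  obtain K where K: "K \<ge> 0" "\<And>g. g \<in> carrier G \<Longrightarrow> d x0 (act g x0) \<le> K * real (word_norm G S g)"
    using displacement_le_word_norm[OF S] by blast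
  obtain A where A: "A \<ge> 0"
      "\<And>g. g \<in> carrier G \<Longrightarrow> real (word_norm G S g) \<le> A * (d x0 (act g x0) + 1)"
    using word_norm_le_displacement[OF S(2,3) chain] by blast
  \<comment> \<open>If \<open>g\<close> moves \<open>x\<close> by at most \<open>len g\<close> and
    \<open>act h x0\<close> is within \<open>D\<close> of \<open>x\<close>, then conjugating by
    \<open>inv h\<close> brings this almost minimal displacement to \<open>x0\<close>, at the cost
    of \<open>D\<close> on either side.\<close>
  have short: "\<exists>h\<in>carrier G. h \<otimes> g \<otimes> inv h \<in> carrier G - {\<one>} \<and>
      d x0 (act (h \<otimes> g \<otimes> inv h) x0) \<le> len g + 2 * D"
    if g: "g \<in> carrier G - {\<one>}" for g
  proof -
    have gc: "g \<in> carrier G" using g by simp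
    obtain x where x: "x \<in> X" "d x (act g x) \<le> len g" using att[OF g] by blast
    obtain h where h: "h \<in> carrier G" "d x (act h x0) \<le> D" using D[OF x(1)] by blast
    have X: "act h x0 \<in> X" "act g x \<in> X" "act g (act h x0) \<in> X"
      using gc h x x0 by (auto simp: act_closed)
    have "d (act h x0) (act g (act h x0)) \<le> d (act h x0) x + d x (act g (act h x0))"
      using X x by (intro d_triangle) auto
    also have "d x (act g (act h x0)) \<le> d x (act g x) + d (act g x) (act g (act h x0))"
      using X x by (intro d_triangle) auto
    finally have "d (act h x0) (act g (act h x0)) \<le> len g + 2 * D"
      using act_isometry[OF gc x(1) X(1)] x(2) h(2) d_commute[OF x(1) X(1)] by linarith
    moreover have "d (act h x0) (act g (act h x0)) = d x0 (act (inv h \<otimes> g \<otimes> inv (inv h)) x0)"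
      using d_act_inv[of "inv h" x0 "act (g \<otimes> h) x0"] h gc X x0 by (simp add: act_mult act_closed m_assoc)
    moreover have "inv h \<otimes> g \<otimes> inv (inv h) \<noteq> \<one>"
      using g h conjugate_eq_one_iff[of g "inv h"] by simp
    ultimately show ?thesis using h gc by (intro bexI[of _ "inv h"]) auto
  qed
  define T where "T = {g \<in> carrier G. d x0 (act g x0) \<le> 1 + 2 * D}"
  \<comment> \<open>An element of length below 1 has a conjugate in the finite set \<open>T\<close>
    with the same length; the inserted 1 covers all others and keeps the set nonempty.\<close>
  define e where "e = Min (insert 1 (len ` (T - {\<one>})))"
  have "finite T" using proper by (simp add: T_def)
  then have e_pos: "e > 0"
    unfolding e_def using pos by (subst Min_gr_iff) (auto simp: T_def)
  have e_le: "e \<le> len g" if g: "g \<in> carrier G - {\<one>}" for g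
  proof (cases "len g \<ge> 1")
    case True
    have "e \<le> 1" unfolding e_def using \<open>finite T\<close> by (intro Min_le) auto
    then show ?thesis using True by simp
  next
    case False
    obtain h where h: "h \<in> carrier G" "h \<otimes> g \<otimes> inv h \<in> carrier G - {\<one>}"
      "d x0 (act (h \<otimes> g \<otimes> inv h) x0) \<le> len g + 2 * D" using short[OF g] by blast
    then have "h \<otimes> g \<otimes> inv h \<in> T - {\<one>}" using False by (auto simp: T_def)
    then have "e \<le> len (h \<otimes> g \<otimes> inv h)"
      unfolding e_def using \<open>finite T\<close> by (intro Min_le) auto
    then show ?thesis using conj[OF g h(1)] by simp
  qed
  \<comment> \<open>\<open>K\<close> bounds lengths by words. The last term comes from A (len g + 2
    D + 1), with the constant A (2 D + 1) multiplied by len g / e \<ge> 1.\<close>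
  define K' where "K' = max 1 (max K (A + A * (2 * D + 1) / e))"
  show ?thesis
  proof (rule growth_equiv_of_length[of K'])
    show "K' \<ge> 1" by (simp add: K'_def)
    show "len g \<le> K' * real (word_norm G S g)" if g: "g \<in> carrier G - {\<one>}" for g
    proof -
      have "len g \<le> K * real (word_norm G S g)" using le[OF g] K(2)[of g] g by auto
      also have "\<dots> \<le> K' * real (word_norm G S g)" by (intro mult_right_mono) (auto simp: K'_def)
      finally show ?thesis .
    qed
    show "\<exists>h\<in>carrier G. real (word_norm G S (h \<otimes> g \<otimes> inv h)) \<le> K' * len g" if g: "g \<in> carrier G - {\<one>}" for g
    proof -
      obtain h where h: "h \<in> carrier G" "h \<otimes> g \<otimes> inv h \<in> carrier G - {\<one>}"
        "d x0 (act (h \<otimes> g \<otimes> inv h) x0) \<le> len g + 2 * D" using short[OF g] by blast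
      have "real (word_norm G S (h \<otimes> g \<otimes> inv h)) \<le> A * (d x0 (act (h \<otimes> g \<otimes> inv h) x0) + 1)"
        using A(2) h(2) by blast
      also have "\<dots> \<le> A * (len g + 2 * D + 1)" using h(3) A(1) by (intro mult_left_mono) auto
      also have "\<dots> = A * len g + A * (2 * D + 1) * 1" by (simp add: algebra_simps)
      also have "\<dots> \<le> A * len g + A * (2 * D + 1) * (len g / e)"
        using e_le[OF g] e_pos A(1) \<open>D \<ge> 0\<close> by (intro add_left_mono mult_left_mono) auto
      also have "\<dots> = (A + A * (2 * D + 1) / e) * len g" by (simp add: distrib_right)
      also have "\<dots> \<le> K' * len g" using pos[OF g] by (intro mult_right_mono) (auto simp: K'_def)
      finally show ?thesis using h(1) by blast
    qed
  qed
qed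

end

section \<open>Lifting to covering spaces of metric spaces\<close>

text \<open>
  The lifting theorems of the library require the base of a covering to lie in a normed space; the
  Kuratowski embedding transfers them to metric spaces.
\<close>

lemma kuratowski_embedding:
  obtains \<iota> :: "'m::metric_space \<Rightarrow> ('m \<Rightarrow>\<^sub>C real)" where "\<And>x y. dist (\<iota> x) (\<iota> y) = dist x y"
proof -
  define a :: 'm where "a = undefined"
  \<comment> \<open>Subtracting the distance from the fixed point \<open>a\<close> makes the
    distance function bounded, by \<open>dist x a\<close>.\<close>
  define \<iota> :: "'m \<Rightarrow> ('m \<Rightarrow>\<^sub>C real)" where "\<iota> x = Bcontfun (\<lambda>z. dist x z - dist a z)" for x
  have \<iota>: "apply_bcontfun (\<iota> x) z = dist x z - dist a z" for x z
  proof -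
    have "(\<lambda>z. dist x z - dist a z) \<in> bcontfun"
    proof (rule bcontfun_normI)
      show "norm (dist x z - dist a z) \<le> dist x a" for z
        using dist_triangle[of x z a] dist_triangle[of a z x] by (simp add: dist_commute)
    qed (intro continuous_intros)
    then show ?thesis by (simp add: \<iota>_def Bcontfun_inverse)
  qed
  show ?thesis
  proof (rule that, rule antisym)
    fix x y
    show "dist (\<iota> x) (\<iota> y) \<le> dist x y"
    proof (rule dist_bound)
      show "dist (\<iota> x z) (\<iota> y z) \<le> dist x y" for z
        using dist_triangle[of x z y] dist_triangle[of y z x] by (simp add: \<iota> dist_real_def dist_commute)
    qed
    \<comment> \<open>The supremum distance is reached by evaluating at \<open>y\<close>, where the
      two functions differ by exactly \<open>dist x y\<close>.\<close>
    show "dist x y \<le> dist (\<iota> x) (\<iota> y)"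
      using dist_bounded[of "\<iota> x" y "\<iota> y"] by (simp add: \<iota> dist_real_def)
  qed
qed

lemma covering_space_homeomorphism_comp:
  assumes cov: "covering_space C p S" and hom: "homeomorphism S T f g"
  shows "covering_space C (f \<circ> p) T"
proof
  have pC: "p ` C = S" and contp: "continuous_on C p"
    using cov by (auto simp: covering_space_def)
  have fg: "f ` S = T" "continuous_on S f" "\<And>x. x \<in> S \<Longrightarrow> g (f x) = x" "\<And>y. y \<in> T \<Longrightarrow> g y \<in> S" "\<And>y. y \<in> T \<Longrightarrow> f (g y) = y"
    using hom by (auto simp: homeomorphism_def)
  show "continuous_on C (f \<circ> p)" using contp fg(2) pC by (intro continuous_on_compose) auto
  show "(f \<circ> p) ` C = T" using pC fg(1) by (metis image_comp)
  fix y assume y: "y \<in> T"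
  obtain W v where W: "g y \<in> W" "openin (top_of_set S) W" "\<Union>v = C \<inter> p -` W"
      "\<forall>u\<in>v. openin (top_of_set C) u" "pairwise disjnt v" "\<forall>u\<in>v. \<exists>q. homeomorphism u W p q"
    using cov fg(4)[OF y] unfolding covering_space_def by metis
  have WS: "W \<subseteq> S" using W(2) openin_imp_subset by blast
  have "C \<inter> (f \<circ> p) -` (f ` W) = C \<inter> p -` W"
  proof -
    have "p x \<in> W" if "x \<in> C" "f (p x) = f w" "w \<in> W" for x w
      using that fg(3)[of "p x"] fg(3)[of w] pC WS by force
    then show ?thesis by auto
  qed
  moreover have "\<exists>q. homeomorphism u (f ` W) (f \<circ> p) q" if u: "u \<in> v" for u
  proof -
    obtain q where q: "homeomorphism u W p q" using W(6) u by blast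
    have "homeomorphism W (f ` W) f g"
      using homeomorphism_of_subsets[OF hom WS _ refl] fg(1) WS by blast
    then show ?thesis using homeomorphism_compose[OF q] by blast
  qed
  moreover have "y \<in> f ` W" using W(1) fg(5)[OF y] by force
  moreover have "openin (top_of_set T) (f ` W)"
    using homeomorphism_imp_open_map[OF hom W(2)] .
  ultimately show "\<exists>U. y \<in> U \<and> openin (top_of_set T) U \<and> (\<exists>v. \<Union>v = C \<inter> (f \<circ> p) -` U \<and>
      (\<forall>u\<in>v. openin (top_of_set C) u) \<and> pairwise disjnt v \<and> (\<forall>u\<in>v. \<exists>q. homeomorphism u U (f \<circ> p) q))"
    using W(3-5) by (intro exI[of _ "f ` W"] conjI exI[of _ v]) auto
qed

lemma covering_space_isometric_comp:
  fixes p :: "'a::topological_space \<Rightarrow> 'b::metric_space" and \<iota> :: "'b \<Rightarrow> 'c::metric_space"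
  assumes cov: "covering_space C p S" and iso: "\<And>x y. dist (\<iota> x) (\<iota> y) = dist x y"
  shows "covering_space C (\<iota> \<circ> p) (\<iota> ` S)"
proof -
  have inj: "inj \<iota>" by (metis dist_eq_0_iff injI iso)
  have "homeomorphism S (\<iota> ` S) \<iota> (inv_into UNIV \<iota>)"
  proof (rule homeomorphismI)
    show "continuous_on S \<iota>" unfolding continuous_on_iff by (metis iso)
    show "continuous_on (\<iota> ` S) (inv_into UNIV \<iota>)"
      unfolding continuous_on_iff using inj iso by (auto simp: inv_f_f)
  qed (auto simp: inj inv_f_f)
  then show ?thesis by (rule covering_space_homeomorphism_comp[OF cov])
qed

lemma metric_covering_lift_strong:
  fixes p :: "'a::real_normed_vector \<Rightarrow> 'b::metric_space" and f :: "'c::real_normed_vector \<Rightarrow> 'b"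
  assumes cov: "covering_space C p S" "a \<in> C" "z \<in> U"
      and scU: "simply_connected U" and lpcU: "locally path_connected U"
      and contf: "continuous_on U f" and fim: "f \<in> U \<rightarrow> S"
      and feq: "f z = p a"
  obtains g where "continuous_on U g" "g \<in> U \<rightarrow> C" "g z = a" "\<And>y. y \<in> U \<Longrightarrow> p (g y) = f y"
proof -
  obtain \<iota> :: "'b \<Rightarrow> ('b \<Rightarrow>\<^sub>C real)" where iso: "\<And>x y. dist (\<iota> x) (\<iota> y) = dist x y"
    using kuratowski_embedding by blast
  have "continuous_on V \<iota>" for V unfolding continuous_on_iff by (metis iso)
  then have "continuous_on U (\<iota> \<circ> f)" using contf by (intro continuous_on_compose)
  moreover have "\<iota> \<circ> f \<in> U \<rightarrow> \<iota> ` S" "(\<iota> \<circ> f) z = (\<iota> \<circ> p) a" using fim feq by auto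
  ultimately show ?thesis
  proof (rule covering_space_lift_strong[OF covering_space_isometric_comp[OF cov(1) iso] cov(2,3) scU lpcU])
    fix g assume g: "continuous_on U g" "g \<in> U \<rightarrow> C" "g z = a"
      "\<And>y. y \<in> U \<Longrightarrow> (\<iota> \<circ> p) (g y) = (\<iota> \<circ> f) y"
    have "p (g y) = f y" if "y \<in> U" for y
      using g(4)[OF that] iso[of "p (g y)" "f y"] by simp
    then show thesis using g(1-3) by (intro that)
  qed
qed

lemma metric_covering_lift_path:
  fixes p :: "'a::real_normed_vector \<Rightarrow> 'b::metric_space"
  assumes cov: "covering_space C p S" and "a \<in> C" "path f" "path_image f \<subseteq> S" "pathstart f = p a"
  obtains h where "path h" "path_image h \<subseteq> C" "pathstart h = a" "\<And>t. t \<in> {0..1} \<Longrightarrow> p (h t) = f t"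
proof (rule metric_covering_lift_strong[OF cov \<open>a \<in> C\<close>, of 0 "{0..1::real}" f])
  show "simply_connected {0..1::real}" "locally path_connected {0..1::real}"
    by (auto intro: convex_imp_simply_connected convex_imp_locally_path_connected)
  show "continuous_on {0..1} f" "f \<in> {0..1} \<rightarrow> S" "f 0 = p a"
    using assms by (auto simp: path_def path_image_def pathstart_def)
qed (auto intro: that simp: path_def path_image_def pathstart_def)

lemma metric_covering_monodromy:
  fixes p :: "'a::real_normed_vector \<Rightarrow> 'b::metric_space"
  assumes cov: "covering_space C p S"
      and hom: "homotopic_paths S (p \<circ> h1) (p \<circ> h2)"
      and "path h1" "path_image h1 \<subseteq> C" "path h2" "path_image h2 \<subseteq> C"
      and "pathstart h1 = pathstart h2"
    shows "pathfinish h1 = pathfinish h2"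
proof -
  obtain \<iota> :: "'b \<Rightarrow> ('b \<Rightarrow>\<^sub>C real)" where iso: "\<And>x y. dist (\<iota> x) (\<iota> y) = dist x y"
    using kuratowski_embedding by blast
  have "continuous_on S \<iota>" unfolding continuous_on_iff by (metis iso)
  then have hom': "homotopic_paths (\<iota> ` S) (\<iota> \<circ> (p \<circ> h1)) (\<iota> \<circ> (p \<circ> h2))"
    by (intro homotopic_paths_continuous_image[OF hom]) auto
  note homotopic_paths_imp_path[OF hom'] homotopic_paths_imp_subset[OF hom']
  then show ?thesis
    using covering_space_monodromy[OF covering_space_isometric_comp[OF cov iso] _ _ _ _ hom' assms(3,4) _ assms(5,6) _ assms(7)]
    by (simp add: o_def)
qed

section \<open>Convex subsets of hyperbolic space\<close>

lemma hyp_convex_geodesic: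
  assumes C: "hyp_convex C" and "x \<in> C" "y \<in> C"
  obtains c where "hyp_geodesic_on {0..hyp_dist x y} c" "continuous_on {0..hyp_dist x y} c"
     "c 0 = x" "c (hyp_dist x y) = y" "c ` {0..hyp_dist x y} \<subseteq> C"
proof (cases "x = y")
  case True
  have "x \<in> hyp_space" using assms by (auto simp: hyp_convex_def)
  then show ?thesis
    using True assms by (intro that[of "\<lambda>_. x"]) (auto simp: hyp_geodesic_on_def)
next
  case False
  have xy: "x \<in> hyp_space" "y \<in> hyp_space" using assms by (auto simp: hyp_convex_def)
  obtain c where c: "hyp_geodesic_on UNIV c" "c 0 = x" "c (hyp_dist x y) = y"
    using hyp_line_through[OF xy False] by blast
  then have c': "hyp_geodesic_on {0..hyp_dist x y} c" by (auto simp: hyp_geodesic_on_def)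
  then have "c ` {0..hyp_dist x y} \<subseteq> C"
    using C c assms(2,3) hyp_dist_nonneg[OF xy] unfolding hyp_convex_def by metis
  then show ?thesis
    using c c' hyp_geodesic_on_continuous[OF c(1)] by (intro that) auto
qed

lemma hyp_convex_chain:
  assumes C: "hyp_convex C" and "x \<in> C" "y \<in> C"
  shows "\<exists>f. f 0 = x \<and> f (nat \<lceil>hyp_dist x y\<rceil>) = y \<and>
       (\<forall>i. f i \<in> C \<and> hyp_dist (f i) (f (Suc i)) \<le> 1)"
proof -
  obtain c where c: "hyp_geodesic_on {0..hyp_dist x y} c"
     "c 0 = x" "c (hyp_dist x y) = y" "c ` {0..hyp_dist x y} \<subseteq> C"
    using hyp_convex_geodesic[OF assms] by metis
  have d: "hyp_dist x y \<ge> 0" using assms by (intro hyp_dist_nonneg) (auto simp: hyp_convex_def)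
  \<comment> \<open>Unit steps along the segment, frozen at \<open>y\<close> by the minimum; the
    last step may be shorter than 1, and rounding the distance up reaches the end.\<close>
  define f where "f i = c (min (real i) (hyp_dist x y))" for i
  have *: "min (real i) (hyp_dist x y) \<in> {0..hyp_dist x y}" for i using d by simp
  have "f 0 = x" using c d by (simp add: f_def)
  moreover have "f (nat \<lceil>hyp_dist x y\<rceil>) = y"
    using c d by (simp add: f_def min_absorb2 real_nat_ceiling_ge)
  moreover have "f i \<in> C" for i using c(4) *[of i] unfolding f_def by blast
  moreover have "hyp_dist (f i) (f (Suc i)) \<le> 1" for i
  proof -
    have "hyp_dist (f i) (f (Suc i)) = \<bar>min (real i) (hyp_dist x y) - min (real (Suc i)) (hyp_dist x y)\<bar>"
      using c(1) *[of i] *[of "Suc i"] unfolding hyp_geodesic_on_def f_def by blast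
    then show ?thesis by simp
  qed
  ultimately show ?thesis by blast
qed

text \<open>Hyperbolic balls in \<open>C\<close> are star-shaped about their centre, since a
  geodesic from \<open>x\<close> to \<open>y\<close> never gets farther from \<open>x\<close> than
  \<open>y\<close> is. The lifting theorem needs this in order to lift \<open>p\<close> itself over
  \<open>C\<close>.\<close>

lemma hyp_convex_locally_path_connected:
  assumes C: "hyp_convex C" shows "locally path_connected C"
proof (rule locallyI)
  fix w x assume w: "openin (top_of_set C) w" "x \<in> w"
  have CH: "C \<subseteq> hyp_space" using C by (simp add: hyp_convex_def)
  have xC: "x \<in> C" using w openin_imp_subset by blast
  then have x: "x \<in> hyp_space" using CH by blast
  from w(1)[unfolded openin_contains_ball, THEN conjunct2, THEN bspec, OF w(2)]
  obtain e where e: "e > 0" "ball x e \<inter> C \<subseteq> w" by (elim exE conjE)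
  obtain r where r: "r > 0" "\<And>y. y \<in> hyp_space \<Longrightarrow> hyp_dist x y < r \<Longrightarrow> dist x y < e"
    using hyp_ball_subset_ball[OF x e(1)] by blast
  define V where "V = C \<inter> hyp_dist x -` {..<r}"
  have "openin (top_of_set C) V" unfolding V_def
    by (rule continuous_openin_preimage_gen) (use CH x in \<open>auto intro!: continuous_on_hyp_dist\<close>)
  moreover have "path_component V x y" if y: "y \<in> V" for y
  proof -
    have yC: "y \<in> C" using y by (simp add: V_def)
    define d where "d = hyp_dist x y"
    have d: "0 \<le> d" "d < r" using y hyp_dist_nonneg[OF x subsetD[OF CH yC]] by (auto simp: d_def V_def)
    obtain c where c: "hyp_geodesic_on {0..d} c" "continuous_on {0..d} c"
     "c 0 = x" "c d = y" "c ` {0..d} \<subseteq> C"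
      using hyp_convex_geodesic[OF C xC yC] unfolding d_def by metis
    have unit: "d * t \<in> {0..d}" if "t \<in> {0..1}" for t
      using that d mult_left_le[of t d] by auto
    have "c (d * t) \<in> V" if t: "t \<in> {0..1}" for t
    proof -
      have "hyp_dist (c 0) (c (d * t)) = \<bar>0 - d * t\<bar>"
        using c(1) unit[OF t] d(1) unfolding hyp_geodesic_on_def by force
      then show ?thesis using unit[OF t] c d unfolding V_def by auto
    qed
    moreover have "path (\<lambda>t. c (d * t))" unfolding path_def
      by (rule continuous_on_compose2[OF c(2)]) (auto intro!: continuous_intros simp: unit[simplified])
    ultimately show ?thesis
      unfolding path_component_def
      by (intro exI[of _ "\<lambda>t. c (d * t)"]) (auto simp: path_image_def pathstart_def pathfinish_def c)
  qed
  then have "path_connected V"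
    unfolding path_connected_component by (meson path_component_sym path_component_trans)
  moreover have "x \<in> V" using xC x r(1) by (simp add: V_def)
  moreover have "V \<subseteq> w"
  proof
    fix y assume "y \<in> V"
    then have "y \<in> C" "dist x y < e" using r(2)[of y] CH by (auto simp: V_def)
    then show "y \<in> w" using e(2) by auto
  qed
  ultimately show "\<exists>U V. openin (top_of_set C) U \<and> path_connected V \<and> x \<in> U \<and> U \<subseteq> V \<and> V \<subseteq> w"
    by blast
qed

section \<open>The covering of a compact hyperbolic manifold\<close>

locale hyperbolic_covering =
  fixes C :: "((real ^ 'n) \<times> real) set" and p :: "(real ^ 'n) \<times> real \<Rightarrow> 'm::metric_space"
    and M :: "'m set" and \<Gamma> :: "((real ^ 'n) \<times> real \<Rightarrow> (real ^ 'n) \<times> real) set"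
  assumes closed: "closed C" and convex: "hyp_convex C" and cov: "covering_space C p M"
    and simply_connected: "simply_connected C"
    and dist_p: "\<And>x y. x \<in> C \<Longrightarrow> y \<in> C \<Longrightarrow> dist (p x) (p y) =
           Inf {hyp_dist x' y' | x' y'. x' \<in> C \<and> y' \<in> C \<and> p x' = p x \<and> p y' = p y}"
    and action: "free_isometric_action \<Gamma>" and prop_disc: "properly_discontinuous \<Gamma>"
    and deck: "(\<lambda>\<gamma>. restrict \<gamma> C) ` \<Gamma> = deck_transformations C p"
    and compact: "compact M"
begin

lemma C_subset: "x \<in> C \<Longrightarrow> x \<in> hyp_space"
  using convex by (auto simp: hyp_convex_def)

definition deck_group where "deck_group = (BijGroup hyp_space) \<lparr>carrier := \<Gamma>\<rparr>"

lemma carrier_deck_group [simp]: "carrier deck_group = \<Gamma>"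
  by (simp add: deck_group_def)

lemma subgroup_\<Gamma>: "subgroup \<Gamma> (BijGroup hyp_space)"
  using action by (simp add: free_isometric_action_def)

lemma group_deck_group: "group deck_group"
  unfolding deck_group_def using subgroup.subgroup_is_group[OF subgroup_\<Gamma> group_BijGroup] .

lemma \<Gamma>_Bij: "\<gamma> \<in> \<Gamma> \<Longrightarrow> \<gamma> \<in> Bij hyp_space"
  using subgroup.subset[OF subgroup_\<Gamma>] by (auto simp: BijGroup_def)

lemma \<Gamma>_closed: "\<gamma> \<in> \<Gamma> \<Longrightarrow> x \<in> hyp_space \<Longrightarrow> \<gamma> x \<in> hyp_space"
  using \<Gamma>_Bij Bij_imp_funcset by blast

lemma \<Gamma>_isometry:
  "\<gamma> \<in> \<Gamma> \<Longrightarrow> x \<in> hyp_space \<Longrightarrow> y \<in> hyp_space \<Longrightarrow> hyp_dist (\<gamma> x) (\<gamma> y) = hyp_dist x y"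
  using action unfolding free_isometric_action_def hyp_isometries_def by blast

lemma one_apply: "x \<in> hyp_space \<Longrightarrow> \<one>\<^bsub>deck_group\<^esub> x = x"
  by (simp add: deck_group_def BijGroup_def)

lemma mult_apply:
  assumes "\<gamma> \<in> \<Gamma>" "\<delta> \<in> \<Gamma>" "x \<in> hyp_space" shows "(\<gamma> \<otimes>\<^bsub>deck_group\<^esub> \<delta>) x = \<gamma> (\<delta> x)"
  using assms \<Gamma>_Bij by (simp add: deck_group_def BijGroup_def compose_def)

lemma \<Gamma>_mult: "\<gamma> \<in> \<Gamma> \<Longrightarrow> \<delta> \<in> \<Gamma> \<Longrightarrow> \<gamma> \<otimes>\<^bsub>deck_group\<^esub> \<delta> \<in> \<Gamma>"
  using monoid.m_closed[OF group.is_monoid[OF group_deck_group]] by simp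

lemma \<Gamma>_inv: "\<gamma> \<in> \<Gamma> \<Longrightarrow> inv\<^bsub>deck_group\<^esub> \<gamma> \<in> \<Gamma>"
  using group.inv_closed[OF group_deck_group] by simp

lemma \<Gamma>_one: "\<one>\<^bsub>deck_group\<^esub> \<in> \<Gamma>"
  using monoid.one_closed[OF group.is_monoid[OF group_deck_group]] by simp

lemma inv_apply:
  assumes "\<gamma> \<in> \<Gamma>" "x \<in> hyp_space"
  shows "(inv\<^bsub>deck_group\<^esub> \<gamma>) (\<gamma> x) = x" "\<gamma> ((inv\<^bsub>deck_group\<^esub> \<gamma>) x) = x"
  using mult_apply[OF \<Gamma>_inv[OF assms(1)] assms] mult_apply[OF assms(1) \<Gamma>_inv[OF assms(1)] assms(2)]
    group.l_inv[OF group_deck_group, of \<gamma>] group.r_inv[OF group_deck_group, of \<gamma>] one_apply[OF assms(2)] assms(1)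
  by auto

lemma free:
  assumes "\<gamma> \<in> \<Gamma>" "x \<in> hyp_space" "\<gamma> x = x" shows "\<gamma> = \<one>\<^bsub>deck_group\<^esub>"
  using action assms unfolding free_isometric_action_def deck_group_def by auto

lemma \<Gamma>_eqI:
  assumes "\<gamma> \<in> \<Gamma>" "\<delta> \<in> \<Gamma>" "x \<in> hyp_space" "\<gamma> x = \<delta> x" shows "\<gamma> = \<delta>"
proof -
  have "(inv\<^bsub>deck_group\<^esub> \<delta> \<otimes>\<^bsub>deck_group\<^esub> \<gamma>) x = x"
    using mult_apply[OF \<Gamma>_inv[OF assms(2)] assms(1,3)] inv_apply[OF assms(2,3)] assms(4) by simp
  then have "inv\<^bsub>deck_group\<^esub> \<delta> \<otimes>\<^bsub>deck_group\<^esub> \<gamma> = \<one>\<^bsub>deck_group\<^esub>"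
    using free[OF \<Gamma>_mult[OF \<Gamma>_inv[OF assms(2)] assms(1)] assms(3)] by blast
  then show ?thesis
    using group.inv_solve_left'[OF group_deck_group, of "\<one>\<^bsub>deck_group\<^esub>" \<delta> \<gamma>] assms(1,2) \<Gamma>_one
     monoid.r_one[OF group.is_monoid[OF group_deck_group], of \<delta>] by simp
qed

lemma
  assumes "\<gamma> \<in> \<Gamma>"
  shows \<Gamma>_C: "x \<in> C \<Longrightarrow> \<gamma> x \<in> C" and p_\<Gamma>: "x \<in> C \<Longrightarrow> p (\<gamma> x) = p x"
    and continuous_on_\<Gamma>: "continuous_on C \<gamma>"
proof -
  have "restrict \<gamma> C \<in> deck_transformations C p" using deck assms by blast
  then have *: "restrict \<gamma> C \<in> Bij C" "\<And>x. x \<in> C \<Longrightarrow> p (restrict \<gamma> C x) = p x"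
     "continuous_on C (restrict \<gamma> C)"
    unfolding deck_transformations_def homeomorphism_def by auto
  show "x \<in> C \<Longrightarrow> \<gamma> x \<in> C" using funcset_mem[OF Bij_imp_funcset[OF *(1)], of x] by simp
  show "x \<in> C \<Longrightarrow> p (\<gamma> x) = p x" using *(2)[of x] by simp
  show "continuous_on C \<gamma>" using *(3) by (simp cong: continuous_on_cong_simp)
qed

lemma continuous_on_p: "continuous_on C p" and p_image: "p ` C = M"
  using cov by (auto simp: covering_space_def)

text \<open>As \<open>C\<close> is simply connected, \<open>p\<close> lifts through itself to
  \<open>g\<close> with \<open>g x = y\<close> and to \<open>h\<close> with \<open>h y = x\<close>.
  Each composite is a lift of \<open>p\<close> with a fixed point, hence the identity, so
  \<open>g\<close> is a deck transformation and extends to an element of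
  \<open>\<Gamma>\<close>.\<close>

lemma fiber_transitive:
  assumes "x \<in> C" "y \<in> C" "p x = p y"
  obtains \<gamma> where "\<gamma> \<in> \<Gamma>" "\<gamma> x = y"
proof -
  have pM: "p \<in> C \<rightarrow> M" using p_image by blast
  note lpc = hyp_convex_locally_path_connected[OF convex]
  obtain g where g: "continuous_on C g" "g \<in> C \<rightarrow> C" "g x = y" "\<And>z. z \<in> C \<Longrightarrow> p (g z) = p z"
    using metric_covering_lift_strong[OF cov assms(2,1) simply_connected lpc continuous_on_p pM assms(3)] by blast
  obtain h where h: "continuous_on C h" "h \<in> C \<rightarrow> C" "h y = x" "\<And>z. z \<in> C \<Longrightarrow> p (h z) = p z"
    using metric_covering_lift_strong[OF cov assms(1,2) simply_connected lpc continuous_on_p pM assms(3)[symmetric]] by blast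
  have conn: "connected C" using simply_connected simply_connected_imp_connected by blast
  have inverse: "k (j z) = z" if j: "continuous_on C j" "j \<in> C \<rightarrow> C" "\<And>z. z \<in> C \<Longrightarrow> p (j z) = p z"
     and k: "continuous_on C k" "k \<in> C \<rightarrow> C" "\<And>z. z \<in> C \<Longrightarrow> p (k z) = p z"
     and a: "k (j a) = a" "a \<in> C" and z: "z \<in> C" for j k a z
  proof -
    have "(k \<circ> j) z = id z"
    proof (rule covering_space_lift_unique[OF cov _ continuous_on_p pM _ _ _ _ _ _ conn a(2) z])
      show "continuous_on C (k \<circ> j)"
        using j k by (intro continuous_on_compose continuous_on_subset[OF k(1)]) auto
    qed (use j k a in \<open>auto simp: Pi_iff\<close>)
    then show ?thesis by simp
  qed
  have hg: "h (g z) = z" if "z \<in> C" for z by (rule inverse[where a = x]) (use that g h assms in auto)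
  have gh: "g (h z) = z" if "z \<in> C" for z by (rule inverse[where a = y]) (use that g h assms in auto)
  have "restrict g C \<in> Bij C"
    unfolding Bij_def using g(2) h(2) hg gh by (auto intro!: bij_betwI[where g = h])
  moreover have "homeomorphism C C (restrict g C) h"
  proof (rule homeomorphismI)
    show "continuous_on C (restrict g C)" using g(1) by (simp cong: continuous_on_cong_simp)
  qed (use g h hg gh in \<open>auto simp: Pi_iff\<close>)
  ultimately have "restrict g C \<in> (\<lambda>\<gamma>. restrict \<gamma> C) ` \<Gamma>"
    unfolding deck using g(4) by (auto simp: deck_transformations_def)
  then obtain \<gamma> where \<gamma>: "restrict g C = restrict \<gamma> C" "\<gamma> \<in> \<Gamma>" by (rule imageE)
  show ?thesis using fun_cong[OF \<gamma>(1), of x] g(3) assms(1) by (intro that[OF \<gamma>(2)]) simp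
qed

section \<open>Proper discontinuity and the local isometry property of the projection\<close>

lemma finite_displacement:
  assumes "x \<in> hyp_space" shows "finite {\<gamma> \<in> \<Gamma>. hyp_dist x (\<gamma> x) \<le> R}"
proof (rule finite_subset)
  \<comment> \<open>\<open>max R 0\<close> keeps \<open>x\<close> in the ball when \<open>R\<close>
    is negative.\<close>
  let ?K = "{y \<in> hyp_space. hyp_dist x y \<le> max R 0}"
  have "x \<in> ?K" using assms by simp
  then show "{\<gamma> \<in> \<Gamma>. hyp_dist x (\<gamma> x) \<le> R} \<subseteq> {\<gamma> \<in> \<Gamma>. \<gamma> ` ?K \<inter> ?K \<noteq> {}}"
    using \<Gamma>_closed[OF _ assms] by (intro Collect_mono) (metis (mono_tags, lifting) IntI empty_iff image_eqI
        max.coboundedI1 mem_Collect_eq)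
  show "finite {\<gamma> \<in> \<Gamma>. \<gamma> ` ?K \<inter> ?K \<noteq> {}}"
    using prop_disc compact_hyp_cball[OF assms] unfolding properly_discontinuous_def by auto
qed

text \<open>Nontrivial deck elements move \<open>x\<close> by at least \<open>4 * e\<close>. For
  \<open>y\<close>, \<open>z\<close> within \<open>e\<close> of \<open>x\<close>, any other pair of
  lifts is then more than \<open>2 * e\<close> apart, whereas \<open>y\<close> and \<open>z\<close>
  are closer than that; so the infimum defining the distance below is attained by \<open>y\<close>
  and \<open>z\<close> themselves.\<close>

lemma injectivity_radius:
  assumes x: "x \<in> C"
  obtains e where "e > 0"
    "\<And>y z. y \<in> C \<Longrightarrow> z \<in> C \<Longrightarrow> hyp_dist x y < e \<Longrightarrow> hyp_dist x z < e \<Longrightarrow> dist (p y) (p z) = hyp_dist y z"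
proof -
  define T where "T = {\<gamma> \<in> \<Gamma>. hyp_dist x (\<gamma> x) \<le> 1} - {\<one>\<^bsub>deck_group\<^esub>}"
  have T: "finite T" using finite_displacement[OF C_subset[OF x], of 1] by (simp add: T_def)
  define e where "e = Min (insert 1 ((\<lambda>\<gamma>. hyp_dist x (\<gamma> x)) ` T)) / 4"
  have "hyp_dist x (\<gamma> x) > 0" if "\<gamma> \<in> T" for \<gamma>
    using that free[of \<gamma> x] C_subset[OF x] \<Gamma>_closed[of \<gamma> x] by (intro hyp_dist_pos) (auto simp: T_def)
  then have "e > 0" unfolding e_def using T by (auto simp: Min_gr_iff)
  have e: "hyp_dist x (\<gamma> x) \<ge> 4 * e" if "\<gamma> \<in> \<Gamma>" "\<gamma> \<noteq> \<one>\<^bsub>deck_group\<^esub>" for \<gamma>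
  proof (cases "\<gamma> \<in> T")
    case True then show ?thesis unfolding e_def using T by (simp add: Min_le_iff)
  next
    case False
    have "4 * e \<le> 1" unfolding e_def using T by (simp add: Min_le_iff)
    then show ?thesis using False that by (simp add: T_def)
  qed
  have "dist (p y) (p z) = hyp_dist y z"
    if y: "y \<in> C" "hyp_dist x y < e" and z: "z \<in> C" "hyp_dist x z < e" for y z
    unfolding dist_p[OF y(1) z(1)]
  proof (rule cInf_eq_minimum)
    show "hyp_dist y z \<in> {hyp_dist x' y' |x' y'. x' \<in> C \<and> y' \<in> C \<and> p x' = p y \<and> p y' = p z}"
      using y z by blast
    fix r assume "r \<in> {hyp_dist x' y' |x' y'. x' \<in> C \<and> y' \<in> C \<and> p x' = p y \<and> p y' = p z}"
    then obtain y' z' where r: "r = hyp_dist y' z'" "y' \<in> C" "z' \<in> C" "p y' = p y" "p z' = p z" by blast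
    obtain \<gamma> where \<gamma>: "\<gamma> \<in> \<Gamma>" "\<gamma> y' = y" using fiber_transitive[OF r(2) y(1) r(4)] .
    obtain \<delta> where \<delta>: "\<delta> \<in> \<Gamma>" "\<delta> z = \<gamma> z'"
      using fiber_transitive[OF z(1) \<Gamma>_C[OF \<gamma>(1) r(3)]] p_\<Gamma>[OF \<gamma>(1) r(3)] r(5) by metis
    have H: "x \<in> hyp_space" "y \<in> hyp_space" "z \<in> hyp_space" "\<delta> x \<in> hyp_space" "\<delta> z \<in> hyp_space"
      using x y(1) z(1) \<delta>(1) by (auto intro: C_subset \<Gamma>_closed)
    have r': "r = hyp_dist y (\<delta> z)"
      using \<Gamma>_isometry[OF \<gamma>(1) C_subset[OF r(2)] C_subset[OF r(3)]] r(1) \<gamma>(2) \<delta>(2) by simp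
    show "hyp_dist y z \<le> r"
    proof (cases "\<delta> = \<one>\<^bsub>deck_group\<^esub>")
      case True then show ?thesis using r' one_apply[OF H(3)] by simp
    next
      case False
      have "hyp_dist x (\<delta> x) \<le> hyp_dist x y + hyp_dist y (\<delta> x)"
         "hyp_dist y (\<delta> x) \<le> hyp_dist y (\<delta> z) + hyp_dist (\<delta> z) (\<delta> x)"
         "hyp_dist (\<delta> z) (\<delta> x) = hyp_dist x z"
         "hyp_dist y z \<le> hyp_dist y x + hyp_dist x z"
        using hyp_dist_triangle H \<Gamma>_isometry[OF \<delta>(1) H(3) H(1)] hyp_dist_commute by metis+
      then show ?thesis
        using e[OF \<delta>(1) False] y z r' hyp_dist_commute[of y x] by linarith
    qed
  qed
  then show ?thesis using that \<open>e > 0\<close> by blast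
qed

lemma cobounded:
  assumes "x \<in> C"
  shows "\<exists>D. \<forall>y\<in>C. \<exists>\<gamma>\<in>\<Gamma>. hyp_dist y (\<gamma> x) \<le> D"
proof -
  have "bounded M" using compact by (rule compact_imp_bounded)
  then obtain D where D: "\<And>a b. a \<in> M \<Longrightarrow> b \<in> M \<Longrightarrow> dist a b \<le> D"
    unfolding bounded_two_points by blast
  have "\<exists>\<gamma>\<in>\<Gamma>. hyp_dist y (\<gamma> x) \<le> D + 1" if y: "y \<in> C" for y
  proof -
    let ?A = "{hyp_dist x' y' | x' y'. x' \<in> C \<and> y' \<in> C \<and> p x' = p y \<and> p y' = p x}"
    have "Inf ?A \<le> D" using dist_p[OF y assms] D[of "p y" "p x"] p_image y assms by auto
    \<comment> \<open>The slack of 1 produces an actual pair of lifts without asking whether the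
      infimum is attained.\<close>
    then have "Inf ?A < D + 1" by simp
    moreover have "?A \<noteq> {}" using y assms by blast
    ultimately obtain r where "r \<in> ?A" "r < D + 1" using cInf_lessD by meson
    then obtain y' x' where r: "hyp_dist y' x' < D + 1" "y' \<in> C" "x' \<in> C" "p y' = p y" "p x' = p x" by blast
    obtain \<gamma> where \<gamma>: "\<gamma> \<in> \<Gamma>" "\<gamma> y' = y" using fiber_transitive[OF r(2) y r(4)] .
    obtain \<delta> where \<delta>: "\<delta> \<in> \<Gamma>" "\<delta> x = \<gamma> x'"
      using fiber_transitive[OF assms \<Gamma>_C[OF \<gamma>(1) r(3)]] p_\<Gamma>[OF \<gamma>(1) r(3)] r(5) by metis
    have "hyp_dist y (\<delta> x) = hyp_dist y' x'"
      using \<Gamma>_isometry[OF \<gamma>(1) C_subset[OF r(2)] C_subset[OF r(3)]] \<gamma>(2) \<delta>(2) by simp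
    then show ?thesis using \<delta>(1) r(1) by force
  qed
  then show ?thesis by blast
qed

end

section \<open>Axes\<close>

context hyperbolic_covering
begin

definition axis :: "((real ^ 'n) \<times> real \<Rightarrow> (real ^ 'n) \<times> real) \<Rightarrow> real \<Rightarrow> (real \<Rightarrow> (real ^ 'n) \<times> real) \<Rightarrow> bool" where
  "axis \<gamma> L c \<longleftrightarrow> L > 0 \<and> hyp_geodesic_on UNIV c \<and> range c \<subseteq> C \<and> (\<forall>t. \<gamma> (c t) = c (t + L))"

lemma geodesic_\<Gamma>:
  assumes "\<gamma> \<in> \<Gamma>" "hyp_geodesic_on UNIV c" shows "hyp_geodesic_on UNIV (\<gamma> \<circ> c)"
proof -
  have "c t \<in> hyp_space" "hyp_dist (c s) (c t) = \<bar>s - t\<bar>" for s t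
    using assms(2) by (auto simp: hyp_geodesic_on_def)
  then show ?thesis
    unfolding hyp_geodesic_on_def using \<Gamma>_isometry[OF assms(1)] \<Gamma>_closed[OF assms(1)] by (simp add: image_subset_iff)
qed

text \<open>\<open>C\<close> need not be compact. A deck element brings any \<open>x\<close> into
  the compact set \<open>K\<close> near \<open>x0\<close>, at the price of replacing
  \<open>\<gamma>\<close> by a conjugate. Conjugates outside the finite set \<open>T\<close>
  displace too much to matter, so the minimum is taken over finitely many functions on
  \<open>K\<close>.\<close>

lemma minimal_displacement:
  assumes \<gamma>: "\<gamma> \<in> \<Gamma>" and x0: "x0 \<in> C"
  obtains y where "y \<in> C" "\<And>x. x \<in> C \<Longrightarrow> hyp_dist y (\<gamma> y) \<le> hyp_dist x (\<gamma> x)"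
proof -
  note H = C_subset
  obtain D' where "\<forall>y\<in>C. \<exists>\<delta>\<in>\<Gamma>. hyp_dist y (\<delta> x0) \<le> D'" using cobounded[OF x0] by blast
  then have "\<forall>y\<in>C. \<exists>\<delta>\<in>\<Gamma>. hyp_dist y (\<delta> x0) \<le> max D' 0" by (meson max.coboundedI1)
  then obtain D where D: "D \<ge> 0" "\<And>y. y \<in> C \<Longrightarrow> \<exists>\<delta>\<in>\<Gamma>. hyp_dist y (\<delta> x0) \<le> D"
    by (meson max.cobounded2)
  define conj where "conj \<delta> = inv\<^bsub>deck_group\<^esub> \<delta> \<otimes>\<^bsub>deck_group\<^esub> (\<gamma> \<otimes>\<^bsub>deck_group\<^esub> \<delta>)" for \<delta>
  have conj_in: "conj \<delta> \<in> \<Gamma>" if "\<delta> \<in> \<Gamma>" for \<delta>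
    unfolding conj_def by (intro \<Gamma>_mult \<Gamma>_inv \<gamma> that)
  have conj_dist: "hyp_dist x (conj \<delta> x) = hyp_dist (\<delta> x) (\<gamma> (\<delta> x))" if "\<delta> \<in> \<Gamma>" "x \<in> hyp_space" for \<delta> x
  proof -
    have "\<delta> (conj \<delta> x) = \<gamma> (\<delta> x)"
      unfolding conj_def using that \<gamma> by (simp add: mult_apply \<Gamma>_inv \<Gamma>_mult \<Gamma>_closed inv_apply)
    then show ?thesis using \<Gamma>_isometry[OF that \<Gamma>_closed[OF conj_in[OF that(1)] that(2)]] by simp
  qed
  \<comment> \<open>A conjugate that moves \<open>x0\<close> by more than \<open>R\<close> moves
    each point of \<open>K\<close> by more than R - 2 D, which is the displacement of
    \<open>x0\<close> by \<open>\<gamma>\<close>; so \<open>x0\<close> itself already does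
    better.\<close>
  define R where "R = hyp_dist x0 (\<gamma> x0) + 2 * D"
  define T where "T = conj ` \<Gamma> \<inter> {\<kappa> \<in> \<Gamma>. hyp_dist x0 (\<kappa> x0) \<le> R}"
  have T: "finite T" unfolding T_def using finite_displacement[OF H[OF x0]] by (rule finite_Int[OF disjI2])
  have conj_one: "conj \<one>\<^bsub>deck_group\<^esub> = \<gamma>"
    using conj_in[OF \<Gamma>_one] \<gamma> C_subset[OF x0]
    by (intro \<Gamma>_eqI[of _ _ x0])
       (auto simp: conj_def mult_apply \<Gamma>_inv \<Gamma>_mult \<Gamma>_closed \<Gamma>_one one_apply monoid.inv_one[OF group.is_monoid[OF group_deck_group]])
  have "hyp_dist x0 (\<gamma> x0) \<le> R" using D(1) by (simp add: R_def)
  then have \<gamma>T: "\<gamma> \<in> T" unfolding T_def using \<gamma> \<Gamma>_one conj_one by (auto intro!: image_eqI[where x = "\<one>\<^bsub>deck_group\<^esub>"])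
  define K where "K = C \<inter> {y \<in> hyp_space. hyp_dist x0 y \<le> D}"
  have K: "compact K" unfolding K_def using closed compact_hyp_cball[OF H[OF x0]] by (rule closed_Int_compact)
  have x0K: "x0 \<in> K" using x0 H[OF x0] D(1) by (simp add: K_def)
  have "\<exists>y\<in>K. \<forall>x\<in>K. hyp_dist y (\<kappa> y) \<le> hyp_dist x (\<kappa> x)" if "\<kappa> \<in> T" for \<kappa>
  proof (rule continuous_attains_inf[OF K])
    have \<kappa>: "\<kappa> \<in> \<Gamma>" using that by (simp add: T_def)
    show "continuous_on K (\<lambda>x. hyp_dist x (\<kappa> x))"
    proof (rule continuous_on_hyp_dist)
      show "continuous_on K \<kappa>" using continuous_on_\<Gamma>[OF \<kappa>] by (rule continuous_on_subset) (auto simp: K_def)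
    qed (use \<Gamma>_closed[OF \<kappa>] in \<open>auto simp: K_def\<close>)
  qed (use x0K in auto)
  then obtain Y where Y: "\<And>\<kappa>. \<kappa> \<in> T \<Longrightarrow> Y \<kappa> \<in> K"
      "\<And>\<kappa> x. \<kappa> \<in> T \<Longrightarrow> x \<in> K \<Longrightarrow> hyp_dist (Y \<kappa>) (\<kappa> (Y \<kappa>)) \<le> hyp_dist x (\<kappa> x)"
    by metis
  obtain \<kappa> where \<kappa>: "\<kappa> \<in> T" "\<And>\<eta>. \<eta> \<in> T \<Longrightarrow> hyp_dist (Y \<kappa>) (\<kappa> (Y \<kappa>)) \<le> hyp_dist (Y \<eta>) (\<eta> (Y \<eta>))"
  proof -
    define f where "f \<kappa> = hyp_dist (Y \<kappa>) (\<kappa> (Y \<kappa>))" for \<kappa>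
    have "Min (f ` T) \<in> f ` T" using T \<gamma>T by (intro Min_in) auto
    then obtain \<kappa> where "\<kappa> \<in> T" "f \<kappa> = Min (f ` T)" by auto
    then show ?thesis using that[of \<kappa>] T by (simp add: f_def)
  qed
  then obtain \<delta> where \<delta>: "\<delta> \<in> \<Gamma>" "\<kappa> = conj \<delta>" by (auto simp: T_def)
  have YC: "Y \<kappa> \<in> C" using Y(1)[OF \<kappa>(1)] by (simp add: K_def)
  have eq: "hyp_dist (\<delta> (Y \<kappa>)) (\<gamma> (\<delta> (Y \<kappa>))) = hyp_dist (Y \<kappa>) (\<kappa> (Y \<kappa>))"
    using conj_dist[OF \<delta>(1) H[OF YC]] \<delta>(2) by simp
  show ?thesis
  proof (rule that)
    show "\<delta> (Y \<kappa>) \<in> C" using \<Gamma>_C[OF \<delta>(1) YC] .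
    fix x assume x: "x \<in> C"
    obtain \<eta> where \<eta>: "\<eta> \<in> \<Gamma>" "hyp_dist x (\<eta> x0) \<le> D" using D(2)[OF x] by blast
    define x' where "x' = (inv\<^bsub>deck_group\<^esub> \<eta>) x"
    have x': "x' \<in> C" "\<eta> x' = x" using \<Gamma>_C[OF \<Gamma>_inv[OF \<eta>(1)] x] inv_apply[OF \<eta>(1) H[OF x]] by (auto simp: x'_def)
    have "hyp_dist x0 x' \<le> D"
      using \<Gamma>_isometry[OF \<eta>(1) H[OF x'(1)] H[OF x0]] \<eta>(2) x'(2) by (simp add: hyp_dist_commute)
    then have x'K: "x' \<in> K" using x' H by (simp add: K_def)
    have c: "hyp_dist x' (conj \<eta> x') = hyp_dist x (\<gamma> x)"
      using conj_dist[OF \<eta>(1) H[OF x'(1)]] x'(2) by simp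
    show "hyp_dist (\<delta> (Y \<kappa>)) (\<gamma> (\<delta> (Y \<kappa>))) \<le> hyp_dist x (\<gamma> x)"
    proof (cases "conj \<eta> \<in> T")
      case True
      then show ?thesis using \<kappa>(2)[OF True] Y(2)[OF True x'K] c eq by linarith
    next
      case False
      then have R: "R < hyp_dist x0 (conj \<eta> x0)" using \<eta>(1) conj_in[OF \<eta>(1)] by (auto simp: T_def)
      have HH: "x0 \<in> hyp_space" "x' \<in> hyp_space" "conj \<eta> x0 \<in> hyp_space" "conj \<eta> x' \<in> hyp_space"
        using H x0 x' \<Gamma>_closed[OF conj_in[OF \<eta>(1)]] by auto
      have "hyp_dist x0 (conj \<eta> x0) \<le> hyp_dist x0 x' + hyp_dist x' (conj \<eta> x0)"
        "hyp_dist x' (conj \<eta> x0) \<le> hyp_dist x' (conj \<eta> x') + hyp_dist (conj \<eta> x') (conj \<eta> x0)"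
        using HH by (auto intro: hyp_dist_triangle)
      moreover have "hyp_dist (conj \<eta> x') (conj \<eta> x0) = hyp_dist x0 x'"
        using \<Gamma>_isometry[OF conj_in[OF \<eta>(1)]] HH hyp_dist_commute by metis
      ultimately have "hyp_dist x0 (\<gamma> x0) \<le> hyp_dist x (\<gamma> x)"
        using R c \<open>hyp_dist x0 x' \<le> D\<close> unfolding R_def by linarith
      then show ?thesis using \<kappa>(2)[OF \<gamma>T] Y(2)[OF \<gamma>T x0K] eq by linarith
    qed
  qed
qed

text \<open>
  A point of minimal displacement lies on an axis: the midpoint of the segment from \<^term>\<open>y\<close> to
  \<^term>\<open>\<gamma> y\<close> is displaced at least as much, so the segment and its image join to a geodesic.
\<close>

lemma axis_exists:
  assumes \<gamma>: "\<gamma> \<in> \<Gamma>" "\<gamma> \<noteq> \<one>\<^bsub>deck_group\<^esub>" and "x0 \<in> C"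
  obtains L c where "axis \<gamma> L c" "\<And>x. x \<in> C \<Longrightarrow> L \<le> hyp_dist x (\<gamma> x)"
proof -
  obtain y where y: "y \<in> C" "\<And>x. x \<in> C \<Longrightarrow> hyp_dist y (\<gamma> y) \<le> hyp_dist x (\<gamma> x)"
    using minimal_displacement[OF \<gamma>(1) assms(3)] by blast
  define m where "m = hyp_dist y (\<gamma> y)"
  have yH: "y \<in> hyp_space" "\<gamma> y \<in> hyp_space" using y \<gamma> C_subset \<Gamma>_closed by auto
  have ne: "y \<noteq> \<gamma> y" using free[OF \<gamma>(1) yH(1)] \<gamma>(2) by auto
  then have m: "m > 0" unfolding m_def using yH by (intro hyp_dist_pos)
  obtain c where c: "hyp_geodesic_on UNIV c" "c 0 = y" "c m = \<gamma> y"
    using hyp_line_through[OF yH ne] unfolding m_def by blast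
  have cH: "c s \<in> hyp_space" and cd: "hyp_dist (c s) (c t) = \<bar>s - t\<bar>" for s t
    using c(1) by (auto simp: hyp_geodesic_on_def)
  have "hyp_geodesic_on {0..m} c" using c(1) by (auto simp: hyp_geodesic_on_def)
  then have seg: "c ` {0..m} \<subseteq> C"
    using convex m c(2,3) y(1) \<Gamma>_C[OF \<gamma>(1) y(1)] unfolding hyp_convex_def by (metis less_imp_le)
  have mid: "c (m/2) \<in> C" using seg m by auto
  have half: "hyp_dist (c m) (\<gamma> (c (m/2))) = m / 2"
    using \<Gamma>_isometry[OF \<gamma>(1) yH(1) cH[of "m/2"]] c(2,3) cd[of 0 "m/2"] m by simp
  moreover from half have "hyp_dist (c (m/2)) (c m) = m / 2" using cd[of "m/2" m] m by simp
  ultimately have "hyp_dist (c (m/2)) (\<gamma> (c (m/2))) = m"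
    using hyp_dist_triangle[OF cH[of "m/2"] cH[of m] \<Gamma>_closed[OF \<gamma>(1) cH[of "m/2"]]] y(2)[OF mid]
    unfolding m_def[symmetric] by linarith
  \<comment> \<open>The image of the midpoint has distance \<open>m\<close> from
    \<open>c (m/2)\<close> and \<open>m/2\<close> from \<open>c m\<close>, exactly as
    \<open>c (m + m/2)\<close> has.\<close>
  with half have "\<gamma> (c (m/2)) = c (m + m/2)"
    using m by (intro hyp_geodesic_extend[OF c(1) \<Gamma>_closed[OF \<gamma>(1) cH], of "m/2" m]) auto
  moreover have "hyp_geodesic_on UNIV (\<lambda>t. c (t + m))"
    using cH cd by (auto simp: hyp_geodesic_on_def)
  ultimately have "\<gamma> \<circ> c = (\<lambda>t. c (t + m))"
    using m c by (intro hyp_geodesic_UNIV_eqI[OF geodesic_\<Gamma>[OF \<gamma>(1) c(1)], of _ 0 "m/2"]) (auto simp: add.commute)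
  then have tr: "\<gamma> (c t) = c (t + m)" for t by (metis comp_apply)
  \<comment> \<open>So far only the segment over {0..m} is known to lie in \<open>C\<close>.
    Invariance of \<open>C\<close> under \<open>\<gamma>\<close> and its inverse spreads this to the
    whole line by multiples of \<open>m\<close>.\<close>
  have shift: "c (t + m) \<in> C \<longleftrightarrow> c t \<in> C" for t
  proof
    assume "c (t + m) \<in> C"
    then have "(inv\<^bsub>deck_group\<^esub> \<gamma>) (\<gamma> (c t)) \<in> C" using \<Gamma>_C[OF \<Gamma>_inv[OF \<gamma>(1)]] by (simp add: tr)
    then show "c t \<in> C" using inv_apply[OF \<gamma>(1) cH] by simp
  qed (use \<Gamma>_C[OF \<gamma>(1)] tr in metis)
  have shifts: "c (t + real_of_int k * m) \<in> C \<longleftrightarrow> c t \<in> C" for t k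
  proof (induction k rule: int_induct[where k = 0])
    case (step1 i)
    then show ?case using shift[of "t + real_of_int i * m"] by (simp add: algebra_simps)
  next
    case (step2 i)
    then show ?case using shift[of "t + real_of_int (i - 1) * m"] by (simp add: algebra_simps)
  qed simp
  have "c t \<in> C" for t
  proof -
    define k where "k = \<lfloor>t / m\<rfloor>"
    have "real_of_int k \<le> t / m" "t / m \<le> real_of_int k + 1" by (auto simp: k_def less_imp_le)
    then have "t - real_of_int k * m \<in> {0..m}" using m by (simp add: field_simps)
    then have "c (t - real_of_int k * m) \<in> C" using seg by blast
    then show ?thesis using shifts[of "t - real_of_int k * m" k] by simp
  qed
  then have "axis \<gamma> m c" using m c(1) tr by (auto simp: axis_def)
  then show ?thesis using that y(2) by (simp add: m_def)
qed

section \<open>Uniqueness of the translation length\<close>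

lemma axis_funpow:
  assumes "axis \<gamma> L c" shows "(\<gamma> ^^ n) (c t) = c (t + real n * L)"
proof (induction n)
  case (Suc n)
  have "\<gamma> (c (t + real n * L)) = c (t + real n * L + L)" using assms by (simp add: axis_def)
  then show ?case using Suc by (simp add: algebra_simps)
qed simp

lemma funpow_closed: "\<gamma> \<in> \<Gamma> \<Longrightarrow> x \<in> hyp_space \<Longrightarrow> (\<gamma> ^^ n) x \<in> hyp_space"
  by (induction n) (auto simp: \<Gamma>_closed)

lemma funpow_isometry:
  "\<gamma> \<in> \<Gamma> \<Longrightarrow> x \<in> hyp_space \<Longrightarrow> y \<in> hyp_space \<Longrightarrow> hyp_dist ((\<gamma> ^^ n) x) ((\<gamma> ^^ n) y) = hyp_dist x y"
  by (induction n) (auto simp: \<Gamma>_isometry funpow_closed)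

text \<open>The n-th power moves \<open>c 0\<close> by n L and \<open>c' 0\<close> by n L', while
  the two orbits keep a constant distance. Hence n (L - L') stays bounded for all n.\<close>

lemma axis_le:
  assumes \<gamma>: "\<gamma> \<in> \<Gamma>" and "axis \<gamma> L c" "axis \<gamma> L' c'" shows "L \<le> L'"
proof (rule ccontr)
  assume "\<not> L \<le> L'"
  have H: "c t \<in> hyp_space" "c' t \<in> hyp_space" and d: "hyp_dist (c s) (c t) = \<bar>s - t\<bar>" "hyp_dist (c' s) (c' t) = \<bar>s - t\<bar>"
    and L: "L > 0" "L' > 0" for s t
    using assms(2,3) by (auto simp: axis_def hyp_geodesic_on_def)
  have "real n * (L - L') \<le> 2 * hyp_dist (c 0) (c' 0)" for n
  proof -
    have "hyp_dist (c 0) (c (real n * L)) \<le> hyp_dist (c 0) (c' 0) + hyp_dist (c' 0) (c (real n * L))"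
      "hyp_dist (c' 0) (c (real n * L)) \<le> hyp_dist (c' 0) (c' (real n * L')) + hyp_dist (c' (real n * L')) (c (real n * L))"
      using H by (auto intro: hyp_dist_triangle)
    moreover have "hyp_dist (c' (real n * L')) (c (real n * L)) = hyp_dist (c 0) (c' 0)"
      using funpow_isometry[OF \<gamma> H(2,1), of n 0 0] axis_funpow[OF assms(2), of n 0] axis_funpow[OF assms(3), of n 0]
      by (simp add: hyp_dist_commute)
    ultimately show ?thesis using L by (simp add: d algebra_simps)
  qed
  moreover obtain n where "2 * hyp_dist (c 0) (c' 0) < real n * (L - L')"
    using reals_Archimedean3[of "L - L'"] \<open>\<not> L \<le> L'\<close> by auto
  ultimately show False by (meson not_less)
qed

lemma axis_unique: "\<gamma> \<in> \<Gamma> \<Longrightarrow> axis \<gamma> L c \<Longrightarrow> axis \<gamma> L' c' \<Longrightarrow> L = L'"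
  using axis_le by (meson antisym)

lemma axis_conjugate:
  assumes \<gamma>: "\<gamma> \<in> \<Gamma>" and \<delta>: "\<delta> \<in> \<Gamma>" and ax: "axis \<gamma> L c"
  shows "axis (\<delta> \<otimes>\<^bsub>deck_group\<^esub> \<gamma> \<otimes>\<^bsub>deck_group\<^esub> inv\<^bsub>deck_group\<^esub> \<delta>) L (\<delta> \<circ> c)"
proof -
  have c: "L > 0" "hyp_geodesic_on UNIV c" "c t \<in> C" "c t \<in> hyp_space" "\<gamma> (c t) = c (t + L)" for t
    using ax by (auto simp: axis_def hyp_geodesic_on_def)
  have "(\<delta> \<otimes>\<^bsub>deck_group\<^esub> \<gamma> \<otimes>\<^bsub>deck_group\<^esub> inv\<^bsub>deck_group\<^esub> \<delta>) (\<delta> (c t)) = \<delta> (c (t + L))" for t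
    using mult_apply[OF \<Gamma>_mult[OF \<delta> \<gamma>] \<Gamma>_inv[OF \<delta>] \<Gamma>_closed[OF \<delta> c(4)]]
      mult_apply[OF \<delta> \<gamma> c(4)] inv_apply[OF \<delta> c(4)] c(5) by simp
  then show ?thesis
    using c geodesic_\<Gamma>[OF \<delta> c(2)] \<Gamma>_C[OF \<delta> c(3)] by (simp add: axis_def image_subset_iff)
qed

section \<open>Axes and closed geodesics\<close>

lemma axis_closed_geodesic:
  assumes "\<gamma> \<in> \<Gamma>" "axis \<gamma> L c" shows "closed_geodesic M L (p \<circ> c)"
proof -
  have c: "L > 0" "c t \<in> C" "\<gamma> (c t) = c (t + L)" "hyp_dist (c s) (c t) = \<bar>s - t\<bar>" for s t
    using assms(2) by (auto simp: axis_def hyp_geodesic_on_def)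
  have "\<exists>e>0. \<forall>s\<in>ball t e. \<forall>s'\<in>ball t e. dist ((p \<circ> c) s) ((p \<circ> c) s') = \<bar>s - s'\<bar>" for t
  proof -
    obtain e where e: "e > 0" "\<And>y z. y \<in> C \<Longrightarrow> z \<in> C \<Longrightarrow> hyp_dist (c t) y < e \<Longrightarrow> hyp_dist (c t) z < e
         \<Longrightarrow> dist (p y) (p z) = hyp_dist y z"
      using injectivity_radius[OF c(2)] by blast
    show ?thesis
      using e(2)[OF c(2) c(2)] by (intro exI[of _ e] conjI e(1)) (auto simp: c(4) dist_real_def)
  qed
  moreover have "p (c (t + L)) = p (c t)" for t using p_\<Gamma>[OF assms(1) c(2)[of t]] by (simp add: c(3))
  ultimately show ?thesis
    using c(1,2) p_image by (auto simp: closed_geodesic_def)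
qed

text \<open>The translate of \<open>c'\<close> by \<open>\<gamma>\<close> and \<open>c'\<close>
  shifted by \<open>L\<close> lift the same curve and agree at 0, hence everywhere. Continuity keeps
  \<open>c'\<close> within the radius where \<open>p\<close> preserves distances for a short time,
  so \<open>c'\<close> is locally, and therefore globally, geodesic.\<close>

lemma lift_closed_geodesic_axis:
  assumes \<gamma>: "\<gamma> \<in> \<Gamma>" and geo: "closed_geodesic M L c"
    and c': "continuous_on UNIV c'" "range c' \<subseteq> C" "\<And>t. p (c' t) = c t" "\<gamma> (c' 0) = c' L"
  shows "axis \<gamma> L c'"
proof -
  have L: "L > 0" "\<And>t. c (t + L) = c t" and C: "c' t \<in> C" for t
    using geo c'(2) by (auto simp: closed_geodesic_def)
  have cont_c: "continuous_on UNIV c"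
    using continuous_on_compose2[OF continuous_on_p c'(1,2)] c'(3) by simp
  have "\<gamma> (c' t) = c' (t + L)" for t
  proof (rule covering_space_lift_unique[OF cov _ cont_c _ _ _ _ _ _ _ connected_UNIV, of "\<lambda>t. \<gamma> (c' t)" 0 "\<lambda>t. c' (t + L)"])
    show "continuous_on UNIV (\<lambda>t. \<gamma> (c' t))"
      by (rule continuous_on_compose2[OF continuous_on_\<Gamma>[OF \<gamma>] c'(1)]) (use C in auto)
    show "continuous_on UNIV (\<lambda>t. c' (t + L))"
      by (rule continuous_on_compose2[OF c'(1)]) (auto intro!: continuous_intros)
  qed (use c' L p_\<Gamma>[OF \<gamma> C] \<Gamma>_C[OF \<gamma> C] C geo in \<open>auto simp: closed_geodesic_def\<close>)
  moreover have "\<exists>e>0. hyp_geodesic_on (ball t e) c'" for t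
  proof -
    obtain e1 where e1: "e1 > 0" "\<And>y z. y \<in> C \<Longrightarrow> z \<in> C \<Longrightarrow> hyp_dist (c' t) y < e1 \<Longrightarrow> hyp_dist (c' t) z < e1
         \<Longrightarrow> dist (p y) (p z) = hyp_dist y z"
      using injectivity_radius[OF C] by blast
    obtain e2 where e2: "e2 > 0" "\<And>s s'. s \<in> ball t e2 \<Longrightarrow> s' \<in> ball t e2 \<Longrightarrow> dist (c s) (c s') = \<bar>s - s'\<bar>"
      using geo unfolding closed_geodesic_def by metis
    have "continuous_on UNIV (\<lambda>s. hyp_dist (c' t) (c' s))"
      using c'(1) C C_subset by (intro continuous_on_hyp_dist) auto
    then have "isCont (\<lambda>s. hyp_dist (c' t) (c' s)) t" by (simp add: continuous_on_eq_continuous_at)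
    then obtain r where r: "r > 0" "\<And>s. dist s t < r \<Longrightarrow> dist (hyp_dist (c' t) (c' s)) (hyp_dist (c' t) (c' t)) < e1"
      unfolding continuous_at_eps_delta using e1(1) by blast
    have near: "hyp_dist (c' t) (c' s) < e1" if "s \<in> ball t r" for s
      using r(2)[of s] that C_subset[OF C, of t] by (simp add: dist_commute dist_real_def)
    have "hyp_dist (c' s) (c' s') = \<bar>s - s'\<bar>" if "s \<in> ball t (min e2 r)" "s' \<in> ball t (min e2 r)" for s s'
      using e1(2)[OF C C near near, of s s'] e2(2)[of s s'] that by (simp add: c'(3))
    then show ?thesis
      using e2(1) r(1) C C_subset by (intro exI[of _ "min e2 r"]) (simp add: hyp_geodesic_on_def image_subset_iff)
  qed
  ultimately show ?thesis
    using L(1) c'(2) hyp_local_geodesic_imp_geodesic[of c'] by (simp add: axis_def)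
qed

end

section \<open>The fundamental group as the deck group\<close>

lemma path_class_eqI: "homotopic_paths M f g \<Longrightarrow> path_class M f = path_class M g"
  unfolding path_class_def by (intro Collect_cong) (meson homotopic_paths_sym homotopic_paths_trans)

lemma path_class_eq_iff:
  assumes "path g" "path_image g \<subseteq> M"
  shows "path_class M f = path_class M g \<longleftrightarrow> homotopic_paths M f g"
proof
  assume "path_class M f = path_class M g"
  moreover have "g \<in> path_class M g" using assms by (simp add: path_class_def)
  ultimately show "homotopic_paths M f g" by (auto simp: path_class_def)
qed (rule path_class_eqI)

lemma fundamental_group_mult_path_class:
  assumes "path f" "path_image f \<subseteq> M" "path g" "path_image g \<subseteq> M" "pathfinish f = pathstart g"
  shows "path_class M f \<otimes>\<^bsub>fundamental_group M x0\<^esub> path_class M g = path_class M (f +++ g)"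
proof -
  have "homotopic_paths M (f +++ g) h"
    if "homotopic_paths M f f'" "homotopic_paths M g g'" "homotopic_paths M (f' +++ g') h" for f' g' h
    using homotopic_paths_join[OF that(1,2) assms(5)] that(3) by (rule homotopic_paths_trans)
  moreover have "f \<in> path_class M f" "g \<in> path_class M g" using assms by (auto simp: path_class_def)
  ultimately have "{h. \<exists>f'\<in>path_class M f. \<exists>g'\<in>path_class M g. homotopic_paths M (f' +++ g') h} = path_class M (f +++ g)"
    unfolding path_class_def by blast
  then show ?thesis by (simp add: fundamental_group_def)
qed

context hyperbolic_covering
begin

lemma homotopic_in_C:
  assumes "path q" "path_image q \<subseteq> C" "path r" "path_image r \<subseteq> C"
    "pathstart q = pathstart r" "pathfinish q = pathfinish r"
  shows "homotopic_paths C q r"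
  using simply_connected assms unfolding simply_connected_eq_homotopic_paths by metis

lemma homotopic_projections:
  assumes "path q" "path_image q \<subseteq> C" "path r" "path_image r \<subseteq> C"
    "pathstart q = pathstart r" "pathfinish q = pathfinish r"
  shows "homotopic_paths M (p \<circ> q) (p \<circ> r)"
  using homotopic_in_C[OF assms] continuous_on_p p_image
  by (intro homotopic_paths_continuous_image[of C]) auto

lemma path_connected_C:
  assumes "x \<in> C" "y \<in> C"
  obtains q where "path q" "path_image q \<subseteq> C" "pathstart q = x" "pathfinish q = y"
  using simply_connected assms simply_connected_imp_path_connected unfolding path_connected_def by metis

lemma path_\<Gamma>:
  assumes "\<gamma> \<in> \<Gamma>" "path q" "path_image q \<subseteq> C"
  shows "path (\<gamma> \<circ> q)" "path_image (\<gamma> \<circ> q) \<subseteq> C"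
proof -
  show "path (\<gamma> \<circ> q)"
    using assms continuous_on_subset[OF continuous_on_\<Gamma>[OF assms(1)]] by (intro path_continuous_image) auto
  show "path_image (\<gamma> \<circ> q) \<subseteq> C"
    using assms(3) \<Gamma>_C[OF assms(1)] by (auto simp: path_image_compose image_subset_iff)
qed

lemma path_p:
  assumes "path q" "path_image q \<subseteq> C"
  shows "path (p \<circ> q)" "path_image (p \<circ> q) \<subseteq> M"
proof -
  show "path (p \<circ> q)"
    using assms continuous_on_subset[OF continuous_on_p] by (intro path_continuous_image) auto
  show "path_image (p \<circ> q) \<subseteq> M"
    using assms(2) p_image by (auto simp: path_image_compose)
qed

text \<open>
  At stage \<open>s\<close> of the homotopy the loop is based at the point \<open>r (1 - s)\<close> of a path \<open>r\<close> from
  \<^term>\<open>pathstart g\<close> to \<^term>\<open>pathstart f\<close>: it follows \<open>r\<close>, then \<open>f\<close>, and returns along \<open>\<gamma> \<circ> r\<close>,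
  which has the same projection as \<open>r\<close>.
\<close>

lemma homotopic_loops_translation:
  assumes \<gamma>: "\<gamma> \<in> \<Gamma>"
    and f: "path f" "path_image f \<subseteq> C" "pathfinish f = \<gamma> (pathstart f)"
    and g: "path g" "path_image g \<subseteq> C" "pathfinish g = \<gamma> (pathstart g)"
  shows "homotopic_loops M (p \<circ> f) (p \<circ> g)"
proof -
  have startC: "pathstart g \<in> C" "pathstart f \<in> C" using f g by auto
  then obtain r where r: "path r" "path_image r \<subseteq> C" "pathstart r = pathstart g" "pathfinish r = pathstart f"
    by (rule path_connected_C)
  have contf: "continuous_on {0..1} f" and contr: "continuous_on {0..1} r"
    using f r by (auto simp: path_def)
  have rC: "r t \<in> C" if "t \<in> {0..1}" for t
    using r(2) that by (auto simp: path_image_def)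
  define k1 where "k1 s t = r (1 - s * (1 - t))" for s t :: real
  define k2 where "k2 s t = \<gamma> (r (1 - s * t))" for s t :: real
  define F where "F s = k1 s +++ (f +++ k2 s)" for s
  have unit: "1 - s * (1 - t) \<in> {0..1}" "1 - s * t \<in> {0..1}" if "s \<in> {0..1}" "t \<in> {0..1}" for s t :: real
    using that by (auto simp: mult_le_one)
  let ?I = "{0..1} \<times> {0..1} :: (real \<times> real) set"
  have c1: "continuous_on ?I (\<lambda>y. k1 (fst y) (snd y))"
    unfolding k1_def using unit(1)
    by (intro continuous_on_compose2[OF contr] continuous_intros) (auto simp: case_prod_unfold)
  have cr: "continuous_on ?I (\<lambda>y. r (1 - fst y * snd y))"
    using unit(2) by (intro continuous_on_compose2[OF contr] continuous_intros) auto
  have c2: "continuous_on ?I (\<lambda>y. k2 (fst y) (snd y))"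
    unfolding k2_def
    by (rule continuous_on_compose2[OF continuous_on_\<Gamma>[OF \<gamma>] cr]) (use unit(2) rC in auto)
  have cf: "continuous_on ?I (\<lambda>y. f (snd y))"
    by (rule continuous_on_compose2[OF contf]) (auto intro!: continuous_intros)
  have ends: "pathfinish (k1 s) = pathstart f" "pathfinish f = pathstart (k2 s)"
    "pathstart (k1 s) = r (1 - s)" "pathfinish (k2 s) = \<gamma> (r (1 - s))" for s
    using r f by (auto simp: k1_def k2_def pathfinish_def pathstart_def)
  have cF: "continuous_on ?I (\<lambda>y. F (fst y) (snd y))"
    unfolding F_def using ends
    by (intro continuous_on_homotopic_join_lemma[where p = k1 and q = "\<lambda>s. f +++ k2 s"]
       continuous_on_homotopic_join_lemma[where p = "\<lambda>s. f" and q = k2] c1 c2 cf) auto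
  have FC: "F s t \<in> C" if "s \<in> {0..1}" "t \<in> {0..1}" for s t
  proof -
    have "path_image (k1 s) \<subseteq> C" "path_image (k2 s) \<subseteq> C"
      using unit[OF that(1)] rC \<Gamma>_C[OF \<gamma> rC] by (auto simp: path_image_def k1_def k2_def image_subset_iff simp del: atLeastAtMost_iff)
    then have "path_image (F s) \<subseteq> C"
      using f(2) path_image_join_subset unfolding F_def by (meson Un_least order_trans)
    then show ?thesis using that(2) by (auto simp: path_image_def)
  qed
  have pathF: "path (F s)" "path_image (F s) \<subseteq> C" if "s \<in> {0..1}" for s
  proof -
    have "continuous_on {0..1} (\<lambda>t. F (fst (s, t)) (snd (s, t)))"
      by (rule continuous_on_compose2[OF cF]) (use that in \<open>auto intro!: continuous_intros\<close>)
    then show "path (F s)" by (simp add: path_def)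
    show "path_image (F s) \<subseteq> C" using FC[OF that] by (auto simp: path_image_def)
  qed
  have endF: "pathstart (F s) = r (1 - s)" "pathfinish (F s) = \<gamma> (r (1 - s))" for s
    by (simp_all add: F_def ends)
  have "homotopic_loops M (p \<circ> F 0) (p \<circ> F 1)"
    unfolding homotopic_loops
  proof (intro exI[of _ "\<lambda>y. p (F (fst y) (snd y))"] conjI ballI)
    show "continuous_on ?I (\<lambda>y. p (F (fst y) (snd y)))"
      by (rule continuous_on_compose2[OF continuous_on_p cF]) (use FC in auto)
    show "(\<lambda>y. p (F (fst y) (snd y))) \<in> ?I \<rightarrow> M" using FC p_image by auto
    show "pathfinish ((\<lambda>y. p (F (fst y) (snd y))) \<circ> Pair t) = pathstart ((\<lambda>y. p (F (fst y) (snd y))) \<circ> Pair t)"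
      if "t \<in> {0..1}" for t
      using endF[of t] that p_\<Gamma>[OF \<gamma> rC[of "1 - t"]] by (simp add: pathfinish_def pathstart_def)
  qed auto
  \<comment> \<open>At stage 0 the loop upstairs has the end points of \<open>f\<close>, at stage 1
    those of \<open>g\<close>; simple connectedness of \<open>C\<close> exchanges the concatenations
    for \<open>f\<close> and \<open>g\<close>.\<close>
  moreover have "homotopic_paths M (p \<circ> f) (p \<circ> F 0)" "homotopic_paths M (p \<circ> g) (p \<circ> F 1)"
    using f g r pathF[of 0] pathF[of 1] endF[of 0] endF[of 1]
    by (auto intro!: homotopic_projections simp: pathstart_def pathfinish_def)
  moreover have "homotopic_loops M u v" if "homotopic_paths M u v" "pathfinish u = pathstart u" for u v
    using homotopic_paths_imp_homotopic_loops[OF that] homotopic_paths_imp_pathfinish[OF that(1)] that(2) by simp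
  moreover have "pathfinish (p \<circ> f) = pathstart (p \<circ> f)" "pathfinish (p \<circ> g) = pathstart (p \<circ> g)"
    using p_\<Gamma>[OF \<gamma> startC(1)] p_\<Gamma>[OF \<gamma> startC(2)] f(3) g(3)
    by (simp_all add: pathfinish_compose pathstart_compose)
  ultimately show ?thesis
    by (meson homotopic_loops_sym homotopic_loops_trans)
qed

end

locale pointed_hyperbolic_covering = hyperbolic_covering C p M \<Gamma>
  for C :: "((real ^ 'n) \<times> real) set" and p :: "(real ^ 'n) \<times> real \<Rightarrow> 'm::metric_space" and M \<Gamma> +
  fixes b :: "(real ^ 'n) \<times> real"
  assumes b: "b \<in> C"
begin

text \<open>The standard identification of the deck group with the fundamental group. The chosen
  path does not matter, because paths in \<open>C\<close> with common ends are homotopic.\<close>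

definition monodromy :: "((real ^ 'n) \<times> real \<Rightarrow> (real ^ 'n) \<times> real) \<Rightarrow> (real \<Rightarrow> 'm) set" where
  "monodromy \<gamma> = path_class M (p \<circ> (SOME q. path q \<and> path_image q \<subseteq> C \<and> pathstart q = b \<and> pathfinish q = \<gamma> b))"

lemma monodromy_eq:
  assumes q: "path q" "path_image q \<subseteq> C" "pathstart q = b" "pathfinish q = \<gamma> b"
  shows "monodromy \<gamma> = path_class M (p \<circ> q)"
proof -
  let ?P = "\<lambda>q. path q \<and> path_image q \<subseteq> C \<and> pathstart q = b \<and> pathfinish q = \<gamma> b"
  have "?P (SOME q. ?P q)" using q by (intro someI[of ?P q]) auto
  then show ?thesis
    unfolding monodromy_def using q by (intro path_class_eqI homotopic_projections) auto
qed

lemma monodromy_path: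
  assumes "\<gamma> \<in> \<Gamma>"
  obtains q where "path q" "path_image q \<subseteq> C" "pathstart q = b" "pathfinish q = \<gamma> b"
     "monodromy \<gamma> = path_class M (p \<circ> q)"
  using path_connected_C[OF b \<Gamma>_C[OF assms b]] monodromy_eq by metis

abbreviation \<pi>\<^sub>1 where "\<pi>\<^sub>1 \<equiv> fundamental_group M (p b)"

text \<open>A path \<open>q\<close> to \<open>\<gamma> b\<close> followed by the translate of
  \<open>r\<close> by \<open>\<gamma>\<close> ends over the product, and the translate has the same
  projection as \<open>r\<close>. The order of the factors is kept, so this is a homomorphism and
  not an antihomomorphism.\<close>

lemma monodromy_mult:
  assumes \<gamma>: "\<gamma> \<in> \<Gamma>" and \<delta>: "\<delta> \<in> \<Gamma>"
  shows "monodromy (\<gamma> \<otimes>\<^bsub>deck_group\<^esub> \<delta>) = monodromy \<gamma> \<otimes>\<^bsub>\<pi>\<^sub>1\<^esub> monodromy \<delta>"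
proof -
  obtain q where q: "path q" "path_image q \<subseteq> C" "pathstart q = b" "pathfinish q = \<gamma> b"
     "monodromy \<gamma> = path_class M (p \<circ> q)" using monodromy_path[OF \<gamma>] .
  obtain r where r: "path r" "path_image r \<subseteq> C" "pathstart r = b" "pathfinish r = \<delta> b"
     "monodromy \<delta> = path_class M (p \<circ> r)" using monodromy_path[OF \<delta>] .
  note r' = path_\<Gamma>[OF \<gamma> r(1,2)]
  have "homotopic_paths M (p \<circ> r) (p \<circ> (\<gamma> \<circ> r))"
    using path_p[OF r(1,2)] p_\<Gamma>[OF \<gamma>, of "r _"] r(2) by (intro homotopic_paths_eq) (auto simp: path_image_def image_subset_iff)
  then have "monodromy \<delta> = path_class M (p \<circ> (\<gamma> \<circ> r))"
    unfolding r(5) by (rule path_class_eqI)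
  then have "monodromy \<gamma> \<otimes>\<^bsub>\<pi>\<^sub>1\<^esub> monodromy \<delta> = path_class M ((p \<circ> q) +++ (p \<circ> (\<gamma> \<circ> r)))"
    unfolding q(5) using path_p[OF q(1,2)] path_p[OF r'] q r
    by (simp add: fundamental_group_mult_path_class pathfinish_compose pathstart_compose)
  also have "(p \<circ> q) +++ (p \<circ> (\<gamma> \<circ> r)) = p \<circ> (q +++ (\<gamma> \<circ> r))"
    by (rule path_compose_join[symmetric])
  also have "path_class M (p \<circ> (q +++ (\<gamma> \<circ> r))) = monodromy (\<gamma> \<otimes>\<^bsub>deck_group\<^esub> \<delta>)"
    using q r r' mult_apply[OF \<gamma> \<delta> C_subset[OF b]]
    by (intro monodromy_eq[symmetric]) (auto simp: pathfinish_compose pathstart_compose path_image_join)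
  finally show ?thesis ..
qed

lemma monodromy_one: "monodromy \<one>\<^bsub>deck_group\<^esub> = \<one>\<^bsub>\<pi>\<^sub>1\<^esub>"
proof -
  have "monodromy \<one>\<^bsub>deck_group\<^esub> = path_class M (p \<circ> (\<lambda>_. b))"
    by (rule monodromy_eq)
       (use b one_apply[OF C_subset[OF b]] in \<open>auto simp: path_def path_image_def pathstart_def pathfinish_def\<close>)
  then show ?thesis by (simp add: fundamental_group_def o_def)
qed

text \<open>Injective since lifts of homotopic paths from \<open>b\<close> end at the same point and
  a deck element is determined by its value at \<open>b\<close>. Surjective since a loop lifts to a
  path ending in the fibre of \<open>b\<close>, on which the deck group is transitive.\<close>

lemma bij_betw_monodromy: "bij_betw monodromy \<Gamma> (carrier \<pi>\<^sub>1)"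
proof (intro bij_betw_imageI inj_onI subset_antisym subsetI)
  fix \<gamma> \<delta> assume \<gamma>: "\<gamma> \<in> \<Gamma>" and \<delta>: "\<delta> \<in> \<Gamma>" and eq: "monodromy \<gamma> = monodromy \<delta>"
  obtain q where q: "path q" "path_image q \<subseteq> C" "pathstart q = b" "pathfinish q = \<gamma> b"
     "monodromy \<gamma> = path_class M (p \<circ> q)" using monodromy_path[OF \<gamma>] .
  obtain r where r: "path r" "path_image r \<subseteq> C" "pathstart r = b" "pathfinish r = \<delta> b"
     "monodromy \<delta> = path_class M (p \<circ> r)" using monodromy_path[OF \<delta>] .
  have "homotopic_paths M (p \<circ> q) (p \<circ> r)"
    using eq path_p[OF r(1,2)] unfolding q(5) r(5) by (simp add: path_class_eq_iff)
  then have "pathfinish q = pathfinish r"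
    by (rule metric_covering_monodromy[OF cov]) (use q r in auto)
  then show "\<gamma> = \<delta>" using q(4) r(4) \<Gamma>_eqI[OF \<gamma> \<delta> C_subset[OF b]] by simp
next
  fix \<alpha> assume "\<alpha> \<in> monodromy ` \<Gamma>"
  then obtain \<gamma> where \<gamma>: "\<gamma> \<in> \<Gamma>" "\<alpha> = monodromy \<gamma>" by blast
  obtain q where q: "path q" "path_image q \<subseteq> C" "pathstart q = b" "pathfinish q = \<gamma> b"
     "monodromy \<gamma> = path_class M (p \<circ> q)" using monodromy_path[OF \<gamma>(1)] .
  have "p \<circ> q \<in> based_loops M (p b)"
    using path_p[OF q(1,2)] q(3,4) p_\<Gamma>[OF \<gamma>(1) b]
    by (simp add: based_loops_def pathfinish_compose pathstart_compose)
  then show "\<alpha> \<in> carrier \<pi>\<^sub>1" using \<gamma>(2) q(5) by (simp add: fundamental_group_def)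
next
  fix \<alpha> assume "\<alpha> \<in> carrier \<pi>\<^sub>1"
  then obtain f where f: "path f" "path_image f \<subseteq> M" "pathstart f = p b" "pathfinish f = p b" "\<alpha> = path_class M f"
    by (auto simp: fundamental_group_def based_loops_def)
  obtain h where h: "path h" "path_image h \<subseteq> C" "pathstart h = b" "\<And>t. t \<in> {0..1} \<Longrightarrow> p (h t) = f t"
    using metric_covering_lift_path[OF cov b f(1-3)] by metis
  have "p (pathfinish h) = p b" using h(4)[of 1] f(4) by (simp add: pathfinish_def)
  moreover have "pathfinish h \<in> C" using h(2) by auto
  ultimately obtain \<gamma> where \<gamma>: "\<gamma> \<in> \<Gamma>" "\<gamma> b = pathfinish h" using fiber_transitive[OF b, of "pathfinish h"] by metis
  have "homotopic_paths M f (p \<circ> h)" using f h(4) by (intro homotopic_paths_eq) auto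
  then have "\<alpha> = path_class M (p \<circ> h)" unfolding f(5) by (rule path_class_eqI)
  also have "\<dots> = monodromy \<gamma>" using h \<gamma>(2) by (intro monodromy_eq[symmetric]) auto
  finally show "\<alpha> \<in> monodromy ` \<Gamma>" using \<gamma>(1) by blast
qed

lemma monodromy_iso: "monodromy \<in> iso deck_group \<pi>\<^sub>1"
  using bij_betw_monodromy monodromy_mult
  by (auto simp: iso_def hom_def bij_betw_def)

lemma group_fundamental_group: "group \<pi>\<^sub>1"
  using group.iso_imp_img_group[OF group_deck_group monodromy_iso] by (simp add: monodromy_one)

text \<open>Lifting a free homotopy to \<^term>\<open>C\<close> lifts the closed geodesic at its end to an axis.\<close>

lemma homotopic_closed_geodesic_axis:
  assumes \<gamma>: "\<gamma> \<in> \<Gamma>" and geo: "closed_geodesic M L c"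
    and f: "f \<in> monodromy \<gamma>" and hom: "homotopic_loops M f (\<lambda>t. c (L * t))"
  obtains c' where "axis \<gamma> L c'"
proof -
  obtain q where q: "path q" "path_image q \<subseteq> C" "pathstart q = b" "pathfinish q = \<gamma> b"
     "monodromy \<gamma> = path_class M (p \<circ> q)" using monodromy_path[OF \<gamma>] .
  have qC: "q t \<in> C" if "t \<in> {0..1}" for t using q(2) that by (auto simp: path_image_def)
  have "homotopic_paths M (p \<circ> q) f" using f q(5) by (simp add: path_class_def)
  moreover have "pathfinish (p \<circ> q) = pathstart (p \<circ> q)"
    using q(3,4) p_\<Gamma>[OF \<gamma> b] by (simp add: pathfinish_compose pathstart_compose)
  ultimately have "homotopic_loops M (p \<circ> q) f"
    by (metis homotopic_paths_imp_homotopic_loops homotopic_paths_imp_pathfinish)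
  then have "homotopic_loops M (p \<circ> q) (\<lambda>t. c (L * t))" using hom by (rule homotopic_loops_trans)
  then obtain h where h: "continuous_on ({0..1::real} \<times> {0..1::real}) h" "h \<in> ({0..1} \<times> {0..1}) \<rightarrow> M"
      "\<And>t. t \<in> {0..1} \<Longrightarrow> h (0, t) = p (q t)" "\<And>t. t \<in> {0..1} \<Longrightarrow> h (1, t) = c (L * t)"
      "\<And>s. s \<in> {0..1} \<Longrightarrow> h (s, 1) = h (s, 0)"
    unfolding homotopic_loops by (auto simp: pathfinish_def pathstart_def)
  let ?I = "{0..1} \<times> {0..1} :: (real \<times> real) set"
  have cvx: "convex ?I" by (intro convex_Times) auto
  have "h (0, 0) = p b" using h(3)[of 0] q(3) by (simp add: pathstart_def)
  then obtain g where g: "continuous_on ?I g" "g \<in> ?I \<rightarrow> C" "g (0, 0) = b" "\<And>y. y \<in> ?I \<Longrightarrow> p (g y) = h y"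
    using metric_covering_lift_strong[OF cov b, of "(0, 0)" ?I h] convex_imp_simply_connected[OF cvx]
      convex_imp_locally_path_connected[OF cvx] h(1,2) by (metis SigmaI atLeastAtMost_iff order_refl zero_le_one)
  have gC: "g (s, t) \<in> C" if "s \<in> {0..1}" "t \<in> {0..1}" for s t using g(2) that by auto
  have pg: "p (g (s, t)) = h (s, t)" if "s \<in> {0..1}" "t \<in> {0..1}" for s t using g(4) that by auto
  have slice1: "continuous_on {0..1} (\<lambda>t. g (s, t))" "continuous_on {0..1} (\<lambda>t. h (s, t))" if "s \<in> {0..1}" for s
    using that by (auto intro!: continuous_on_compose2[OF g(1)] continuous_on_compose2[OF h(1)] continuous_intros)
  have slice2: "continuous_on {0..1} (\<lambda>s. g (s, t))" "continuous_on {0..1} (\<lambda>s. h (s, t))" if "t \<in> {0..1}" for t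
    using that by (auto intro!: continuous_on_compose2[OF g(1)] continuous_on_compose2[OF h(1)] continuous_intros)
  have conn: "connected {0..1::real}" by (rule connected_Icc)
  \<comment> \<open>The side s = 0 of the lifted square is the path \<open>q\<close>, so its corners
    differ by \<open>\<gamma>\<close>.\<close>
  have "g (0, 1) = q 1"
  proof (rule covering_space_lift_unique[OF cov, of "\<lambda>t. g (0, t)" 0 q "{0..1}" "\<lambda>t. h (0, t)" 1])
    show "g (0, 0) = q 0" using g(3) q(3) by (simp add: pathstart_def)
  qed (use slice1[of 0] q(1) qC gC pg h(2,3) conn in \<open>auto simp: path_def\<close>)
  then have start: "g (0, 1) = \<gamma> (g (0, 0))" using q(4) g(3) by (simp add: pathfinish_def)
  \<comment> \<open>The base point of the loop traces one path in \<open>M\<close>; the sides t = 1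
    and t = 0 both lift it and differ by \<open>\<gamma>\<close> at s = 0, hence also at s =
    1.\<close>
  have "g (1, 1) = \<gamma> (g (1, 0))"
  proof (rule covering_space_lift_unique[OF cov, of "\<lambda>s. g (s, 1)" 0 "\<lambda>s. \<gamma> (g (s, 0))" "{0..1}" "\<lambda>s. h (s, 0)" 1])
    show "continuous_on {0..1} (\<lambda>s. \<gamma> (g (s, 0)))"
      by (rule continuous_on_compose2[OF continuous_on_\<Gamma>[OF \<gamma>] slice2(1)]) (use gC in auto)
  qed (use start slice2[of 0] slice2[of 1] gC pg h(2,5) \<Gamma>_C[OF \<gamma>] p_\<Gamma>[OF \<gamma>] conn in auto)
  \<comment> \<open>Continuity is not part of \<open>closed_geodesic\<close>; it follows from the
    local isometry condition.\<close>
  moreover have c_cont: "continuous_on UNIV c"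
  proof (rule continuous_at_imp_continuous_on, intro ballI)
    fix t
    obtain e where e: "e > 0" "\<And>s s'. s \<in> ball t e \<Longrightarrow> s' \<in> ball t e \<Longrightarrow> dist (c s) (c s') = \<bar>s - s'\<bar>"
      using geo unfolding closed_geodesic_def by metis
    have near: "dist (c s) (c t) = \<bar>s - t\<bar>" if "dist s t < e" for s
      using e(2)[of s t] e(1) that by (simp add: dist_commute)
    show "isCont c t"
      unfolding continuous_at_eps_delta
    proof (intro allI impI)
      fix r :: real assume "r > 0"
      then show "\<exists>d>0. \<forall>s. dist s t < d \<longrightarrow> dist (c s) (c t) < r"
        using e(1) near by (intro exI[of _ "min e r"]) (auto simp: dist_real_def)
    qed
  qed
  moreover have "c 0 = p (g (1, 0))" using pg[of 1 0] h(4)[of 0] by simp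
  moreover have cM: "c \<in> UNIV \<rightarrow> M" using geo by (auto simp: closed_geodesic_def)
  moreover have "g (1, 0) \<in> C" using gC by simp
  ultimately obtain c' where c': "continuous_on UNIV c'" "c' \<in> UNIV \<rightarrow> C" "c' 0 = g (1, 0)" "\<And>t. p (c' t) = c t"
    using metric_covering_lift_strong[OF cov _ UNIV_I convex_imp_simply_connected[OF convex_UNIV]
       convex_imp_locally_path_connected[OF convex_UNIV], of "g (1, 0)" c 0] by (metis UNIV_I)
  \<comment> \<open>The side s = 1 is one period of the lifted geodesic, so its end corner is
    \<open>c' L\<close>.\<close>
  have "c' (L * 1) = g (1, 1)"
  proof (rule covering_space_lift_unique[OF cov, of "\<lambda>t. c' (L * t)" 0 "\<lambda>t. g (1, t)" "{0..1}" "\<lambda>t. h (1, t)" 1])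
    show "continuous_on {0..1} (\<lambda>t. c' (L * t))"
      by (rule continuous_on_compose2[OF c'(1)]) (auto intro!: continuous_intros)
  qed (use c' slice1[of 1] gC pg h(2,4) conn in auto)
  then have "\<gamma> (c' 0) = c' L" using \<open>g (1, 1) = \<gamma> (g (1, 0))\<close> c'(3) by simp
  then have "axis \<gamma> L c'" using c' by (intro lift_closed_geodesic_axis[OF \<gamma> geo]) auto
  then show ?thesis by (rule that)
qed

text \<open>Discharges the definite description. Existence: the axis projects to a closed geodesic,
  freely homotopic to the loop because both lifts run from a point to its image under
  \<open>\<gamma>\<close>. Uniqueness: any competing geodesic lifts to another axis of
  \<open>\<gamma>\<close>.\<close>

lemma geodesic_length_monodromy:
  assumes \<gamma>: "\<gamma> \<in> \<Gamma>" and ax: "axis \<gamma> L c"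
  shows "geodesic_length M (monodromy \<gamma>) = L"
  unfolding geodesic_length_def
proof (rule the_equality)
  have c: "L > 0" "hyp_geodesic_on UNIV c" "c t \<in> C" "\<gamma> (c t) = c (t + L)" for t
    using ax by (auto simp: axis_def)
  obtain q where q: "path q" "path_image q \<subseteq> C" "pathstart q = b" "pathfinish q = \<gamma> b"
     "monodromy \<gamma> = path_class M (p \<circ> q)" using monodromy_path[OF \<gamma>] .
  have "path (\<lambda>t. c (L * t))" unfolding path_def
    by (rule continuous_on_compose2[OF hyp_geodesic_on_continuous[OF c(2)]]) (auto intro!: continuous_intros)
  then have "homotopic_loops M (p \<circ> q) (p \<circ> (\<lambda>t. c (L * t)))"
    using q c(3) c(4)[of 0]
    by (intro homotopic_loops_translation[OF \<gamma>]) (auto simp: path_image_def pathfinish_def pathstart_def)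
  moreover have "p \<circ> q \<in> monodromy \<gamma>" using q(5) path_p[OF q(1,2)] by (simp add: path_class_def)
  ultimately show "\<exists>c. closed_geodesic M L c \<and> (\<exists>f\<in>monodromy \<gamma>. homotopic_loops M f (\<lambda>t. c (L * t)))"
    using axis_closed_geodesic[OF \<gamma> ax] by (intro exI[of _ "p \<circ> c"] conjI bexI[of _ "p \<circ> q"]) (auto simp: o_def)
next
  fix L' assume "\<exists>c. closed_geodesic M L' c \<and> (\<exists>f\<in>monodromy \<gamma>. homotopic_loops M f (\<lambda>t. c (L' * t)))"
  then obtain c' where "axis \<gamma> L' c'" using homotopic_closed_geodesic_axis[OF \<gamma>] by metis
  then show "L' = L" using axis_unique[OF \<gamma>] ax by blast
qed

section \<open>The action of the fundamental group on the universal cover\<close>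

abbreviation act where "act \<equiv> inv_into \<Gamma> monodromy"

lemma act_in: "\<alpha> \<in> carrier \<pi>\<^sub>1 \<Longrightarrow> act \<alpha> \<in> \<Gamma>"
  and monodromy_act: "\<alpha> \<in> carrier \<pi>\<^sub>1 \<Longrightarrow> monodromy (act \<alpha>) = \<alpha>"
  and act_monodromy: "\<gamma> \<in> \<Gamma> \<Longrightarrow> act (monodromy \<gamma>) = \<gamma>"
  using bij_betw_monodromy by (auto simp: bij_betw_def inv_into_into f_inv_into_f)

lemma act_mult:
  assumes "\<alpha> \<in> carrier \<pi>\<^sub>1" "\<beta> \<in> carrier \<pi>\<^sub>1"
  shows "act (\<alpha> \<otimes>\<^bsub>\<pi>\<^sub>1\<^esub> \<beta>) = act \<alpha> \<otimes>\<^bsub>deck_group\<^esub> act \<beta>"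
  using monodromy_mult[OF act_in[OF assms(1)] act_in[OF assms(2)]] monodromy_act assms
    act_monodromy[OF \<Gamma>_mult[OF act_in[OF assms(1)] act_in[OF assms(2)]]] by simp

lemma act_one: "act \<one>\<^bsub>\<pi>\<^sub>1\<^esub> = \<one>\<^bsub>deck_group\<^esub>"
  using act_monodromy[OF \<Gamma>_one] by (simp add: monodromy_one)

sublocale cobounded_action \<pi>\<^sub>1 C hyp_dist act b
proof -
  interpret group \<pi>\<^sub>1 by (rule group_fundamental_group)
  show "cobounded_action \<pi>\<^sub>1 C hyp_dist act b"
  proof
    show "\<exists>D. \<forall>x\<in>C. \<exists>\<alpha>\<in>carrier \<pi>\<^sub>1. hyp_dist x (act \<alpha> b) \<le> D"
      using cobounded[OF b] act_monodromy bij_betw_monodromy unfolding bij_betw_def by (metis imageI)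
    show "finite {\<alpha> \<in> carrier \<pi>\<^sub>1. hyp_dist b (act \<alpha> b) \<le> R}" for R
    proof (rule finite_subset)
      show "{\<alpha> \<in> carrier \<pi>\<^sub>1. hyp_dist b (act \<alpha> b) \<le> R} \<subseteq> monodromy ` {\<gamma> \<in> \<Gamma>. hyp_dist b (\<gamma> b) \<le> R}"
      proof
        fix \<alpha> assume "\<alpha> \<in> {\<alpha> \<in> carrier \<pi>\<^sub>1. hyp_dist b (act \<alpha> b) \<le> R}"
        then show "\<alpha> \<in> monodromy ` {\<gamma> \<in> \<Gamma>. hyp_dist b (\<gamma> b) \<le> R}"
          using act_in monodromy_act by (intro image_eqI[of _ _ "act \<alpha>"]) auto
      qed
    qed (intro finite_imageI finite_displacement C_subset b)
  qed (use b C_subset act_in in \<open>auto simp: hyp_dist_nonneg hyp_dist_commute act_mult act_one one_apply mult_apply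
      \<Gamma>_C \<Gamma>_isometry intro: hyp_dist_triangle\<close>)
qed

lemma axis_act:
  assumes "\<alpha> \<in> carrier \<pi>\<^sub>1 - {\<one>\<^bsub>\<pi>\<^sub>1\<^esub>}"
  obtains c where "axis (act \<alpha>) (geodesic_length M \<alpha>) c"
    "\<And>x. x \<in> C \<Longrightarrow> geodesic_length M \<alpha> \<le> hyp_dist x (act \<alpha> x)"
proof -
  have \<alpha>: "\<alpha> \<in> carrier \<pi>\<^sub>1" "\<alpha> \<noteq> \<one>\<^bsub>\<pi>\<^sub>1\<^esub>" using assms by auto
  have "act \<alpha> \<noteq> \<one>\<^bsub>deck_group\<^esub>"
    using monodromy_act[OF \<alpha>(1)] monodromy_one \<alpha>(2) by metis
  then obtain L c where Lc: "axis (act \<alpha>) L c" "\<And>x. x \<in> C \<Longrightarrow> L \<le> hyp_dist x (act \<alpha> x)"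
    using axis_exists[OF act_in[OF \<alpha>(1)] _ b] by blast
  moreover have "geodesic_length M \<alpha> = L"
    using geodesic_length_monodromy[OF act_in[OF \<alpha>(1)] Lc(1)] monodromy_act[OF \<alpha>(1)] by simp
  ultimately show ?thesis using that by blast
qed

theorem growth_equiv_residual_finiteness:
  assumes S: "finite S" "S \<subseteq> carrier \<pi>\<^sub>1" "generate \<pi>\<^sub>1 S = carrier \<pi>\<^sub>1"
  shows "growth_equiv (residual_finiteness \<pi>\<^sub>1 S) (geodesic_residual_finiteness M (p b))"
proof -
  have "growth_equiv (residual_finiteness \<pi>\<^sub>1 S)
     (\<lambda>r. max_or_one (divisibility \<pi>\<^sub>1 ` {\<alpha> \<in> carrier \<pi>\<^sub>1 - {\<one>\<^bsub>\<pi>\<^sub>1\<^esub>}. geodesic_length M \<alpha> \<le> r}))"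
  proof (rule growth_equiv_translation_length[OF S hyp_convex_chain[OF convex b]])
    fix \<alpha> assume \<alpha>: "\<alpha> \<in> carrier \<pi>\<^sub>1 - {\<one>\<^bsub>\<pi>\<^sub>1\<^esub>}"
    then have \<alpha>': "\<alpha> \<in> carrier \<pi>\<^sub>1" by simp
    obtain c where c: "axis (act \<alpha>) (geodesic_length M \<alpha>) c"
      "\<And>x. x \<in> C \<Longrightarrow> geodesic_length M \<alpha> \<le> hyp_dist x (act \<alpha> x)"
      using axis_act[OF \<alpha>] by metis
    show "geodesic_length M \<alpha> > 0" using c(1) by (simp add: axis_def)
    show "geodesic_length M \<alpha> \<le> hyp_dist b (act \<alpha> b)" using c(2)[OF b] .
    have "c 0 \<in> C" "hyp_dist (c 0) (act \<alpha> (c 0)) = geodesic_length M \<alpha>"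
      using c(1) by (auto simp: axis_def hyp_geodesic_on_def)
    then show "\<exists>x\<in>C. hyp_dist x (act \<alpha> x) \<le> geodesic_length M \<alpha>" by (intro bexI[of _ "c 0"]) auto
    fix \<beta> assume \<beta>: "\<beta> \<in> carrier \<pi>\<^sub>1"
    \<comment> \<open>The deck element of the conjugate class: its axis is the translate of
      \<open>c\<close> by \<open>act \<beta>\<close>, with the same translation length.\<close>
    let ?\<gamma> = "act \<beta> \<otimes>\<^bsub>deck_group\<^esub> act \<alpha> \<otimes>\<^bsub>deck_group\<^esub> inv\<^bsub>deck_group\<^esub> act \<beta>"
    interpret mon: group_hom deck_group \<pi>\<^sub>1 monodromy
      using monodromy_iso group_deck_group group_fundamental_group
      by (simp add: group_hom_def group_hom_axioms_def iso_def)
    have "monodromy ?\<gamma> = \<beta> \<otimes>\<^bsub>\<pi>\<^sub>1\<^esub> \<alpha> \<otimes>\<^bsub>\<pi>\<^sub>1\<^esub> inv\<^bsub>\<pi>\<^sub>1\<^esub> \<beta>"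
      using act_in[OF \<alpha>'] act_in[OF \<beta>] monodromy_act[OF \<alpha>'] monodromy_act[OF \<beta>]
        \<Gamma>_mult[OF act_in[OF \<beta>] act_in[OF \<alpha>']] \<Gamma>_inv[OF act_in[OF \<beta>]]
      by (simp add: monodromy_mult mon.hom_inv)
    moreover have "?\<gamma> \<in> \<Gamma>" by (intro \<Gamma>_mult \<Gamma>_inv act_in \<alpha>' \<beta>)
    ultimately show "geodesic_length M (\<beta> \<otimes>\<^bsub>\<pi>\<^sub>1\<^esub> \<alpha> \<otimes>\<^bsub>\<pi>\<^sub>1\<^esub> inv\<^bsub>\<pi>\<^sub>1\<^esub> \<beta>) = geodesic_length M \<alpha>"
      using geodesic_length_monodromy axis_conjugate[OF act_in[OF \<alpha>'] act_in[OF \<beta>] c(1)] by metis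
  qed
  then show ?thesis unfolding geodesic_residual_finiteness_def .
qed

end

theorem lemma6p1:
  fixes M :: "'m::metric_space set" and x0 :: 'm and S :: "(real \<Rightarrow> 'm) set set"
  assumes "compact_hyperbolic_manifold TYPE('n::finite) M"
    and "x0 \<in> M"
    and "finite S"
    and "S \<subseteq> carrier (fundamental_group M x0)"
    and "generate (fundamental_group M x0) S = carrier (fundamental_group M x0)"
  shows "growth_equiv (residual_finiteness (fundamental_group M x0) S)
                      (geodesic_residual_finiteness M x0)"
proof -
  obtain C :: "((real ^ 'n) \<times> real) set" and p \<Gamma> where cov: "hyperbolic_covering C p M \<Gamma>"
    using assms(1) unfolding compact_hyperbolic_manifold_def
    by (elim conjE exE) (rule that, unfold_locales, auto)
  then have "p ` C = M" by (rule hyperbolic_covering.p_image)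
  \<comment> \<open>A point over \<open>x0\<close> turns the given fundamental group into the one
    based at \<open>p b\<close>.\<close>
  then obtain b where b: "b \<in> C" and x0_eq: "x0 = p b" using assms(2) by blast
  interpret pointed_hyperbolic_covering C p M \<Gamma> b
    using cov b by (simp add: pointed_hyperbolic_covering_def pointed_hyperbolic_covering_axioms_def)
  show ?thesis
    using growth_equiv_residual_finiteness assms(3-5) unfolding x0_eq .
qed

end
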